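(* Let $(B^H_t)_{t\in T}$ be a fractional Brownian motion with Hurst index $H$, let $x\in\mathbb{R}$, $f\in C^{0,1}_b(T\times\mathbb{R})$, and let $(X_t)_{t\in T}$ be the solution of $$X_t = x+\int_0^t f(s,X_s)\,ds + B^H_t,\qquad t\in T .$$ Let $\Delta=n^{-\alpha}$ and assume that one of the following two settings holds: (i) $T=[0,1]$, $H\in(0,1)$ and $\alpha\ge 1$ (so that the observations do not leave the unit interval); or (ii) $T=\mathbb{R}^+$, $H\le\frac12$ and $\alpha>0$ is arbitrary (so that for $\alpha<1$ the observation window $n\Delta$ grows with $n$). Let $a^{(1)},\dots,a^{(m)}$ be filters of respective lengths $p_1+1,\dots,p_m+1$ such that the associated matrix $A$ (defined in the context) is of full rank, and let $\hat H_1,\hat H_2$ be the associated estimators (defined in the context). Then both estimators are strongly consistent: as $n\to\infty$, $$\hat H_1\xrightarrow{\text{a.s.}}H\qquad\text{and}\qquad \hat H_2\xrightarrow{\text{a.s.}}H .$$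
   Context: Fractional Brownian motion $(B^H_t)_{t\in T}$ with Hurst index $H\in(0,1)$ on an interval $T$ is the centered Gaussian process with covariance $\mathbb{E}[B^H_tB^H_s]=\frac12(t^{2H}+s^{2H}-|t-s|^{2H})$. $f\in C^{0,1}_b(T\times\mathbb{R})$ means that $f(s,x)$ is continuous in the time component $s$, continuously differentiable in the space component $x$, and that $f$ and its derivative $f'$ with respect to the second variable are bounded, $\|f\|_\infty+\|f'\|_\infty\le M$ for a fixed constant $M>0$. A filter of length $p+1$ ($p\in\mathbb{N}$, $p\ge1$) is a tuple $a=(a_0,\dots,a_p)$ of real numbers, not identically zero, with $\sum_{q=0}^p a_q=0$. For a filter $a$ of length $p+1$, a process $Z$, and mesh size $\Delta>0$, put $\Delta_aZ_j=\sum_{i=0}^p a_i Z_{(i+j)\Delta}$ and, for $n>p$, $U(a,n,\Delta,Z)=\frac1n\sum_{j=1}^{n-p}(\Delta_aZ_j)^2$. Estimators. Given filters $a^{(i)}=(a^{(i)}_0,\dots,a^{(i)}_{p_i})$, $i=1,\dots,m$, let $P=\max_i p_i$ and let $A=(A_{ij})\in\mathbb{R}^{m\times P}$ be given by $A_{ij}=-\sum_{k=0}^{p_i-j}a^{(i)}_ka^{(i)}_{k+j}$ for $j\le p_i$ and $A_{ij}=0$ otherwise. The filters are chosen such that $A$ is of full rank, in the sense that $A^TA$ is invertible. Let $U_n=(U(a^{(i)},n,\Delta,X))_{i=1,\dots,m}$ and $\hat D=(A^TA)^{-1}A^TU_n\in\mathbb{R}^P$. Define $$\hat H_1=\frac{\sum_{d=1}^P\log|\hat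 D_d|\,\log(d\Delta)}{2\sum_{d=1}^P\log(d\Delta)^2},$$ $$\hat H_2=\frac{\sum_{d=1}^P\log|\hat D_d|\log(d)-\frac1P\sum_{d=1}^P\log|\hat D_d|\sum_{d=1}^P\log(d)}{2\left(\sum_{d=1}^P\log(d)^2-\frac1P\left(\sum_{d=1}^P\log(d)\right)^2\right)},$$ where $\log(\cdot)^2$ denotes the square of the logarithm. For $\hat H_2$ to be defined one takes $P\ge2$. *)

theory Defs
  imports "HOL-Probability.Probability" "Jordan_Normal_Form.Gauss_Jordan_Elimination"
begin

text \<open>A real Gaussian random variable; the first disjunct is the normal law with variance zero
  (e.g. the value of fractional Brownian motion at time 0).\<close>

definition gaussian_rv :: "'a measure \<Rightarrow> ('a \<Rightarrow> real) \<Rightarrow> bool" where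
  "gaussian_rv M Z \<longleftrightarrow> Z \<in> borel_measurable M \<and>
     ((\<exists>\<mu>. AE \<omega> in M. Z \<omega> = \<mu>) \<or>
      (\<exists>\<mu> \<sigma>. \<sigma> > 0 \<and> distributed M lborel Z (normal_density \<mu> \<sigma>)))"

text \<open>Finite-dimensional distributions are jointly Gaussian, i.e. all finite linear combinations
  are Gaussian.\<close>

definition gaussian_process :: "'a measure \<Rightarrow> real set \<Rightarrow> (real \<Rightarrow> 'a \<Rightarrow> real) \<Rightarrow> bool" where
  "gaussian_process M T Z \<longleftrightarrow>
     (\<forall>J c. finite J \<and> J \<subseteq> T \<longrightarrow> gaussian_rv M (\<lambda>\<omega>. \<Sum>t\<in>J. c t * Z t \<omega>))"

definition fractional_brownian_motion ::
    "'a measure \<Rightarrow> real set \<Rightarrow> real \<Rightarrow> (real \<Rightarrow> 'a \<Rightarrow> real) \<Rightarrow> bool" where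
  "fractional_brownian_motion M T H B \<longleftrightarrow>
     0 < H \<and> H < 1 \<and> gaussian_process M T B \<and>
     (\<forall>t\<in>T. (LINT \<omega>|M. B t \<omega>) = 0) \<and>
     (\<forall>t\<in>T. \<forall>s\<in>T. (LINT \<omega>|M. B t \<omega> * B s \<omega>) =
        1 / 2 * (t powr (2 * H) + s powr (2 * H) - \<bar>t - s\<bar> powr (2 * H)))"

text \<open>The boundedness conjuncts make the two suprema genuine sup norms.\<close>

definition C01b :: "real \<Rightarrow> real set \<Rightarrow> (real \<Rightarrow> real \<Rightarrow> real) \<Rightarrow> bool" where
  "C01b K T f \<longleftrightarrow>
     (\<forall>x. continuous_on T (\<lambda>s. f s x)) \<and>
     (\<forall>s\<in>T. (\<forall>x. f s differentiable (at x)) \<and> continuous_on UNIV (deriv (f s))) \<and>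
     bdd_above ((\<lambda>(s, x). \<bar>f s x\<bar>) ` (T \<times> UNIV)) \<and>
     bdd_above ((\<lambda>(s, x). \<bar>deriv (f s) x\<bar>) ` (T \<times> UNIV)) \<and>
     (SUP (s, x)\<in>T \<times> UNIV. \<bar>f s x\<bar>) + (SUP (s, x)\<in>T \<times> UNIV. \<bar>deriv (f s) x\<bar>) \<le> K"

text \<open>Pathwise solution of the equation with additive noise. Integrability is part of the notion,
  since the integral of a non-integrable function is 0 by convention.\<close>

definition sde_solution ::
    "'a measure \<Rightarrow> real set \<Rightarrow> real \<Rightarrow> (real \<Rightarrow> real \<Rightarrow> real) \<Rightarrow>
     (real \<Rightarrow> 'a \<Rightarrow> real) \<Rightarrow> (real \<Rightarrow> 'a \<Rightarrow> real) \<Rightarrow> bool" where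
  "sde_solution M T x f B X \<longleftrightarrow>
     (\<forall>t\<in>T. X t \<in> borel_measurable M) \<and>
     (AE \<omega> in M. \<forall>t\<in>T.
        set_integrable lborel {0..t} (\<lambda>s. f s (X s \<omega>)) \<and>
        X t \<omega> = x + (LINT s:{0..t}|lborel. f s (X s \<omega>)) + B t \<omega>)"

text \<open>A filter of length $p+1$ is a list of that length.\<close>

definition is_increment_filter :: "real list \<Rightarrow> bool" where
  "is_increment_filter a \<longleftrightarrow> length a \<ge> 2 \<and> (\<exists>q<length a. a ! q \<noteq> 0) \<and> (\<Sum>q<length a. a ! q) = 0"

definition filter_order :: "real list \<Rightarrow> nat" where
  "filter_order a = length a - 1"

definition filtered_increment :: "real list \<Rightarrow> real \<Rightarrow> (real \<Rightarrow> real) \<Rightarrow> nat \<Rightarrow> real" where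
  "filtered_increment a \<Delta> z j = (\<Sum>i=0..filter_order a. a ! i * z (real (i + j) * \<Delta>))"

definition filtered_quadratic_variation :: "real list \<Rightarrow> nat \<Rightarrow> real \<Rightarrow> (real \<Rightarrow> real) \<Rightarrow> real" where
  "filtered_quadratic_variation a n \<Delta> z =
     1 / real n * (\<Sum>j=1..n - filter_order a. (filtered_increment a \<Delta> z j)\<^sup>2)"

definition max_order :: "real list list \<Rightarrow> nat" where
  "max_order as = Max (filter_order ` set as)"

text \<open>Matrix and vector indices start at 0, so column \<open>j\<close> belongs to lag \<open>j + 1\<close>.\<close>

definition filter_matrix :: "real list list \<Rightarrow> real mat" where
  "filter_matrix as = mat (length as) (max_order as) (\<lambda>(i, j).
     let a = as ! i; p = filter_order a; d = j + 1 in
     if d \<le> p then - (\<Sum>k=0..p - d. a ! k * a ! (k + d)) else 0)"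

definition full_rank :: "real mat \<Rightarrow> bool" where
  "full_rank A \<longleftrightarrow> invertible_mat (transpose_mat A * A)"

definition D_hat :: "real list list \<Rightarrow> nat \<Rightarrow> real \<Rightarrow> (real \<Rightarrow> real) \<Rightarrow> real vec" where
  "D_hat as n \<Delta> z =
     (let A = filter_matrix as;
          U = vec (length as) (\<lambda>i. filtered_quadratic_variation (as ! i) n \<Delta> z)
      in (the (mat_inverse (transpose_mat A * A)) * transpose_mat A) *\<^sub>v U)"

definition log_D_hat :: "real list list \<Rightarrow> nat \<Rightarrow> real \<Rightarrow> (real \<Rightarrow> real) \<Rightarrow> nat \<Rightarrow> real" where
  "log_D_hat as n \<Delta> z d = ln \<bar>vec_index (D_hat as n \<Delta> z) (d - 1)\<bar>"

definition H1_hat :: "real list list \<Rightarrow> nat \<Rightarrow> real \<Rightarrow> (real \<Rightarrow> real) \<Rightarrow> real" where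
  "H1_hat as n \<Delta> z =
     (\<Sum>d=1..max_order as. log_D_hat as n \<Delta> z d * ln (real d * \<Delta>)) /
     (2 * (\<Sum>d=1..max_order as. (ln (real d * \<Delta>))\<^sup>2))"

definition H2_hat :: "real list list \<Rightarrow> nat \<Rightarrow> real \<Rightarrow> (real \<Rightarrow> real) \<Rightarrow> real" where
  "H2_hat as n \<Delta> z =
     (let P = max_order as; L = log_D_hat as n \<Delta> z in
      ((\<Sum>d=1..P. L d * ln (real d))
         - 1 / real P * (\<Sum>d=1..P. L d) * (\<Sum>d=1..P. ln (real d))) /
      (2 * ((\<Sum>d=1..P. (ln (real d))\<^sup>2) - 1 / real P * (\<Sum>d=1..P. ln (real d))\<^sup>2)))"

end

theory Submission
  imports Defs "HOL-Real_Asymp.Real_Asymp"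
begin

text \<open>The drift has Lipschitz paths, so it changes the filtered increments by only \<open>O(\<Delta>)\<close>, which
  is negligible against their size \<open>\<Delta> powr H\<close>; hence the quadratic variations of \<open>X\<close> and \<open>B\<close>,
  rescaled by \<open>\<Delta> powr (- 2 * H)\<close>, have the same limit. For \<open>B\<close> the rows of the triangular array
  of increments share no usable dependence structure across \<open>n\<close>, so the strong law is obtained row by row
  from Borel--Cantelli. Variances are not summable for \<open>H\<close> near 1, so an exponential inequality is needed:
  with independent standard Gaussian \<open>G\<close>, the exponential moment of \<open>\<lambda> |Y|\<^sup>2\<close> equals that of
  \<open>\<lambda> G\<^sup>T R G\<close>, where \<open>R\<close> is the covariance of \<open>Y\<close>, and this is bounded by integrating out one coordinate
  at a time. The operator norm of \<open>R\<close> is at most its maximal row sum \<open>O(n powr (1 - b))\<close>, which suffices.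
  The limit of the rescaled quadratic variations is \<open>A v\<close> with \<open>v\<^sub>d = d powr (2 * H)\<close>; the left
  inverse of \<open>A\<close> recovers \<open>v\<close>, and taking logarithms gives a noise-free regression.\<close>

section \<open>Gaussian integrals of exponentials of quadratic forms\<close>

text \<open>Covariance matrices are never diagonalised; only values of quadratic forms and entrywise
  row sums are used. The spectral estimate E exp(\<sigma>/2 g^T S g) = det(I - \<sigma> S)^(-1/2)
  \<le> exp(\<sigma>/2 tr S / (1 - \<sigma> \<kappa>)) for 0 \<le> S \<le> \<kappa> is therefore
  replaced by an induction on the dimension, and \<sigma> = 1 or -1 carries the upper and the lower
  tail through the same argument. The trace encodes the mean of |Y|^2, so the first-order term
  cancels against the centring and an excess of order \<lambda>^2 r tr R remains, where r bounds the
  row sums. With r = C n^(1-b) and tr R = O(n), the choice \<lambda> = n^(-1+b/2) keeps this excess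
  bounded, while a deviation of size n^(1-b/4) = o(n) contributes \<lambda> n^(1-b/4) = n^(b/4) to
  the exponent, which is summable. Any b > 0 is thus enough, and for every H < 1 the decay k^(2H-2)
  of the autocovariance of a zero-sum filter provides one. After rescaling by \<Delta>^(-H) this
  autocovariance no longer depends on the mesh, so one b serves all rows.\<close>

definition quad :: "nat \<Rightarrow> (nat \<Rightarrow> nat \<Rightarrow> real) \<Rightarrow> (nat \<Rightarrow> real) \<Rightarrow> real" where
  "quad n S x = (\<Sum>i<n. \<Sum>j<n. S i j * x i * x j)"

lemma quad_Suc:
  assumes sym: "\<And>i j. S i j = S j i"
  shows "quad (Suc n) S x = quad n S x + 2 * x n * (\<Sum>i<n. S i n * x i) + S n n * (x n)\<^sup>2"
proof -
  have "(\<Sum>j<n. S n j * x n * x j) = x n * (\<Sum>i<n. S i n * x i)"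
    unfolding sum_distrib_left by (rule sum.cong) (auto simp: sym[of n] mult_ac)
  moreover have "(\<Sum>i<n. S i n * x i * x n) = x n * (\<Sum>i<n. S i n * x i)"
    unfolding sum_distrib_left by (rule sum.cong) (auto simp: mult_ac)
  ultimately show ?thesis
    by (simp add: quad_def sum.distrib power2_eq_square mult_ac)
qed

lemma quad_cong: "(\<And>i. i < n \<Longrightarrow> x i = y i) \<Longrightarrow> quad n S x = quad n S y"
  unfolding quad_def by (intro sum.cong refl) auto

text \<open>Eliminating one coordinate of a Gaussian quadratic form changes the remaining block by a
  multiple of u u^T, so the induction stays among forms of type \<open>quad\<close>.\<close>

lemma quad_rank_one_update:
  "quad n (\<lambda>i j. S i j + c * u i * u j) x = quad n S x + c * (\<Sum>i<n. u i * x i)\<^sup>2"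
proof -
  have "(\<Sum>i<n. \<Sum>j<n. c * u i * u j * x i * x j) = c * (\<Sum>i<n. u i * x i)\<^sup>2"
    unfolding power2_eq_square sum_product sum_distrib_left
    by (intro sum.cong refl) (simp add: sum_distrib_left mult_ac)
  thus ?thesis by (simp add: quad_def distrib_right sum.distrib)
qed

lemma quad_scale: "quad n S (\<lambda>i. c * x i) = c\<^sup>2 * quad n S x"
  unfolding quad_def sum_distrib_left power2_eq_square
  by (intro sum.cong refl) (simp add: mult_ac)

lemma sum_lessThan_fun_upd: "(\<Sum>i<n. h i ((x(n := y)) i)) = (\<Sum>i<n. h i (x i))" for h :: "nat \<Rightarrow> real \<Rightarrow> real"
  by (intro sum.cong) auto

text \<open>For \<open>0 \<le> S \<le> \<kappa>\<close> one has \<open>S\<^sup>2 \<le> \<kappa> S\<close>; this is the last diagonal entry.\<close>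

lemma quad_last_column_bound:
  assumes sym: "\<And>i j. S i j = S j i" and k: "\<kappa> > 0"
    and psd: "\<And>x. 0 \<le> quad (Suc n) S x"
    and ub: "\<And>x. quad (Suc n) S x \<le> \<kappa> * (\<Sum>i<Suc n. (x i)\<^sup>2)"
  shows "(\<Sum>i<n. (S i n)\<^sup>2) \<le> \<kappa> * S n n - (S n n)\<^sup>2"
proof -
  define m where "m = (\<Sum>i<n. (S i n)\<^sup>2)"
  define s where "s = S n n"
  \<comment> \<open>With e the last unit vector, \<open>u\<close> is S e and \<open>v\<close> is
    \<kappa> e - S e. Testing S \<le> \<kappa> on the first and S \<ge> 0 on the second uses the
    identity S (\<kappa> - S) S + (\<kappa> - S) S (\<kappa> - S) = \<kappa> S (\<kappa> - S), which
    avoids a square root of S.\<close>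
  define u where "u = (\<lambda>i. S i n)"
  define w where "w = quad n S u"
  define v where "v = (\<lambda>i. (-1) * u i)(n := \<kappa> - s)"
  have mu: "(\<Sum>i<n. S i n * u i) = m" by (simp add: m_def u_def power2_eq_square)
  have "w + 2 * s * m + s ^ 3 \<le> \<kappa> * (m + s\<^sup>2)"
  proof -
    have un: "u n = s" "(\<Sum>i<n. (u i)\<^sup>2) = m" by (simp_all add: u_def s_def m_def)
    thus ?thesis using ub[of u] unfolding quad_Suc[OF sym] mu w_def[symmetric] s_def[symmetric]
      by (simp add: un power2_eq_square power3_eq_cube)
  qed
  moreover have "quad n S v = w"
  proof -
    have "quad n S v = quad n S (\<lambda>i. (-1) * u i)" by (rule quad_cong) (simp add: v_def)
    thus ?thesis unfolding quad_scale w_def by simp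
  qed
  moreover have "(\<Sum>i<n. S i n * v i) = - m"
    unfolding mu[symmetric] sum_negf[symmetric] by (intro sum.cong) (auto simp: v_def)
  moreover have "v n = \<kappa> - s" by (simp add: v_def)
  ultimately have "0 \<le> w - 2 * (\<kappa> - s) * m + s * (\<kappa> - s)\<^sup>2"
    and "w + 2 * s * m + s ^ 3 \<le> \<kappa> * (m + s\<^sup>2)"
    using psd[of v] unfolding quad_Suc[OF sym] by (simp_all add: s_def[symmetric])
  hence "0 \<le> \<kappa> * (\<kappa> * s - s\<^sup>2 - m)"
    by (simp add: algebra_simps power2_eq_square power3_eq_cube)
  with k have "0 \<le> \<kappa> * s - s\<^sup>2 - m" by (simp add: zero_le_mult_iff)
  thus ?thesis by (simp add: m_def s_def)
qed

section \<open>Standard Gaussian product measures and one-dimensional exponential integrals\<close>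

abbreviation gauss_prod :: "nat \<Rightarrow> (nat \<Rightarrow> real) measure" where
  "gauss_prod n \<equiv> Pi\<^sub>M {..<n} (\<lambda>_. std_normal_distribution)"

lemma prob_space_std_normal: "prob_space std_normal_distribution"
  using real_dist_normal_dist by (simp add: real_distribution_def)

lemma product_prob_space_std_normal: "product_prob_space (\<lambda>_. std_normal_distribution)"
  using prob_space_std_normal by (simp add: product_prob_space_def product_prob_space_axioms_def
    product_sigma_finite_def prob_space_imp_sigma_finite)

lemma borel_measurable_quad [measurable]: "quad n S \<in> borel_measurable (gauss_prod n)"
proof -
  have "(\<lambda>x. x i) \<in> borel_measurable (gauss_prod n)" if "i < n" for i
    using measurable_component_singleton[of i "{..<n}" "\<lambda>_. std_normal_distribution"] that
    by (simp cong: measurable_cong_sets)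
  thus ?thesis unfolding quad_def
    by (intro borel_measurable_sum borel_measurable_times) auto
qed

lemma nn_integral_normal_density:
  assumes s: "\<sigma> > 0"
  shows "(\<integral>\<^sup>+y. ennreal (normal_density \<mu> \<sigma> y) \<partial>lborel) = 1"
  using s by (subst nn_integral_eq_integral) auto

text \<open>Completing the square turns the integrand into a multiple of the normal density with
  mean c / (1 - d) and variance 1 / (1 - d). The case d = 0 is the moment generating
  function.\<close>

lemma nn_integral_std_normal_exp:
  assumes d: "d < 1"
  shows "(\<integral>\<^sup>+y. ennreal (exp (c * y + d * y\<^sup>2 / 2)) \<partial>std_normal_distribution) =
    ennreal (exp (c\<^sup>2 / (2 * (1 - d))) / sqrt (1 - d))"
proof -
  let ?K = "exp (c\<^sup>2 / (2 * (1 - d))) / sqrt (1 - d)"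
  let ?\<mu> = "c / (1 - d)" and ?\<sigma> = "1 / sqrt (1 - d)"
  have eq: "std_normal_density y * exp (c * y + d * y\<^sup>2 / 2) = ?K * normal_density ?\<mu> ?\<sigma> y" for y
  proof -
    have s2: "?\<sigma>\<^sup>2 = 1 / (1 - d)" using d by (simp add: power_divide)
    have e: "- y\<^sup>2 / 2 + (c * y + d * y\<^sup>2 / 2) =
        c\<^sup>2 / (2 * (1 - d)) + - (y - ?\<mu>)\<^sup>2 / (2 * ?\<sigma>\<^sup>2)"
    proof -
      define r where "r = 1 - d"
      have r: "r > 0" "d = 1 - r" using d by (auto simp: r_def)
      show ?thesis unfolding s2 unfolding r(2) using r(1)
        by (simp add: field_simps power2_eq_square)
    qed
    have sq: "sqrt (2 * pi * ?\<sigma>\<^sup>2) = sqrt (2 * pi) / sqrt (1 - d)"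
      unfolding s2 by (simp add: real_sqrt_divide)
    have "std_normal_density y * exp (c * y + d * y\<^sup>2 / 2) =
        1 / sqrt (2 * pi) * exp (- y\<^sup>2 / 2 + (c * y + d * y\<^sup>2 / 2))"
      unfolding exp_add by (simp add: std_normal_density_def)
    also have "\<dots> = 1 / sqrt (2 * pi) * (exp (c\<^sup>2 / (2 * (1 - d))) * exp (- (y - ?\<mu>)\<^sup>2 / (2 * ?\<sigma>\<^sup>2)))"
      unfolding e exp_add ..
    also have "\<dots> = ?K * normal_density ?\<mu> ?\<sigma> y"
      unfolding normal_density_def sq using d by simp
    finally show ?thesis .
  qed
  have "(\<integral>\<^sup>+y. ennreal (exp (c * y + d * y\<^sup>2 / 2)) \<partial>std_normal_distribution) =
      (\<integral>\<^sup>+y. ennreal ?K * ennreal (normal_density ?\<mu> ?\<sigma> y) \<partial>lborel)"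
    using d by (subst nn_integral_density) (auto simp: ennreal_mult[symmetric] eq)
  also have "\<dots> = ennreal ?K"
    using d by (subst nn_integral_cmult) (auto simp: nn_integral_normal_density)
  finally show ?thesis .
qed

text \<open>This is - ln (1 - t) \<le> t / (1 - t) in exponential form, from 1 + x \<le> exp x at x
  = t / (1 - t). It bounds the normalising factor left by one integrated coordinate; negative t
  occurs for \<sigma> = -1.\<close>

lemma inverse_sqrt_le_exp:
  assumes "t < 1" shows "1 / sqrt (1 - t) \<le> exp (t / (2 * (1 - t)))"
proof -
  have "1 / (1 - t) = 1 + t / (1 - t)" using assms by (simp add: field_simps)
  also have "\<dots> \<le> exp (t / (1 - t))" by (rule exp_ge_add_one_self)
  finally have "sqrt (1 / (1 - t)) \<le> sqrt (exp (t / (1 - t)))" by simp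
  also have "\<dots> = exp (t / (2 * (1 - t)))"
  proof (rule real_sqrt_unique)
    have "t / (2 * (1 - t)) + t / (2 * (1 - t)) = t / (1 - t)"
      using field_sum_of_halves[of "t / (1 - t)"] by (simp add: mult.commute)
    thus "(exp (t / (2 * (1 - t))))\<^sup>2 = exp (t / (1 - t))"
      unfolding power2_eq_square exp_add[symmetric] by simp
  qed simp
  finally show ?thesis by (simp add: real_sqrt_divide)
qed

text \<open>Integrating out the last coordinate replaces \<open>I - \<sigma> S\<close> by its Schur complement, which
  inherits the bounds \<open>0 \<le> S \<le> \<kappa>\<close>.\<close>

lemma nn_integral_exp_quad_le:
  assumes "\<And>i j. S i j = S j i" and k: "0 < \<kappa>" "\<kappa> < 1" and sg: "\<sigma> = 1 \<or> \<sigma> = - 1"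
    and "\<And>x. 0 \<le> quad n S x" and "\<And>x. quad n S x \<le> \<kappa> * (\<Sum>i<n. (x i)\<^sup>2)"
  shows "(\<integral>\<^sup>+g. ennreal (exp (\<sigma> / 2 * quad n S g)) \<partial>gauss_prod n) \<le>
    ennreal (exp (\<sigma> / 2 * (\<Sum>i<n. S i i) / (1 - \<sigma> * \<kappa>)))"
  using assms(1,5-)
proof (induction n arbitrary: S)
  case 0
  interpret product_prob_space "\<lambda>_. std_normal_distribution" "{..<0::nat}"
    by (rule product_prob_space_std_normal)
  show ?case by (simp add: quad_def PiM_empty)
next
  case (Suc n)
  note sym = Suc.prems(1) and psd = Suc.prems(2) and ub = Suc.prems(3)
  interpret product_prob_space "\<lambda>_. std_normal_distribution" "{..<n::nat}"
    by (rule product_prob_space_std_normal)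
  define s where "s = S n n"
  define m where "m = (\<Sum>i<n. (S i n)\<^sup>2)"
  define b where "b = (\<lambda>x :: nat \<Rightarrow> real. \<Sum>i<n. S i n * x i)"
  \<comment> \<open>Since \<sigma>^2 = 1, this is the coefficient for which I - \<sigma> S' is the
    Schur complement of the last diagonal entry 1 - \<sigma> s in I - \<sigma> S.\<close>
  define c where "c = \<sigma> / (1 - \<sigma> * s)"
  define S' where "S' = (\<lambda>i j. S i j + c * S i n * S j n)"
  have m: "m \<le> \<kappa> * s - s\<^sup>2"
    using quad_last_column_bound[OF sym k(1) psd ub] by (simp add: m_def s_def)
  have s0: "0 \<le> s" "s \<le> \<kappa>"
  proof -
    have e: "quad (Suc n) S ((\<lambda>_. 0)(n := 1)) = s"
      unfolding quad_Suc[OF sym] by (simp add: s_def quad_def)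
    show "0 \<le> s" using psd e by metis
    have "quad (Suc n) S ((\<lambda>_. 0)(n := 1)) \<le> \<kappa> * (\<Sum>i<Suc n. (((\<lambda>_. 0)(n := 1)) i)\<^sup>2)"
      by (rule ub)
    thus "s \<le> \<kappa>" unfolding e by (simp add: power2_eq_square if_distrib)
  qed
  have d1: "1 - \<sigma> * s > 0" "1 - \<sigma> * \<kappa> > 0" using sg s0 k by auto
  have quad': "quad n S' x = quad n S x + c * (b x)\<^sup>2" for x
    unfolding S'_def b_def by (rule quad_rank_one_update)
  have split: "quad (Suc n) S (x(n := y)) = quad n S x + 2 * y * b x + s * y\<^sup>2" for x y
  proof -
    have "quad n S (x(n := y)) = quad n S x" by (rule quad_cong) simp
    moreover have "(\<Sum>i<n. S i n * (x(n := y)) i) = b x" unfolding b_def by (rule sum_lessThan_fun_upd)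
    ultimately show ?thesis unfolding quad_Suc[OF sym] by (simp add: s_def)
  qed
  have sq: "(\<Sum>i<Suc n. ((x(n := y)) i)\<^sup>2) = (\<Sum>i<n. (x i)\<^sup>2) + y\<^sup>2" for x :: "nat \<Rightarrow> real" and y
    using sum_lessThan_fun_upd[of "\<lambda>_ z. z\<^sup>2" x n y] by simp
  \<comment> \<open>The inserted value c * b x is the stationary point of y \<mapsto>
    \<open>quad (Suc n) S (x(n := y))\<close> - \<sigma> y^2. This identity yields the upper bound
    on \<open>S'\<close> for \<sigma> = 1 and the lower bound for \<sigma> = -1; the other two
    bounds follow from the sign of \<open>c\<close>.\<close>
  have key: "quad n S' x = quad (Suc n) S (x(n := c * b x)) - \<sigma> * (c * b x)\<^sup>2" for x
  proof -
    have "c = 2 * c + s * c\<^sup>2 - \<sigma> * c\<^sup>2"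
    proof -
      have "c * (1 - \<sigma> * s) = \<sigma>" using d1 by (simp add: c_def)
      moreover have "s - \<sigma> = - \<sigma> * (1 - \<sigma> * s)" "\<sigma> * \<sigma> = 1" using sg by auto
      moreover have "(s - \<sigma>) * c\<^sup>2 = - \<sigma> * (c * (1 - \<sigma> * s)) * c"
        unfolding \<open>s - \<sigma> = - \<sigma> * (1 - \<sigma> * s)\<close> by (simp add: power2_eq_square mult_ac)
      ultimately have "(s - \<sigma>) * c\<^sup>2 = - c" by simp
      thus ?thesis by (simp add: algebra_simps)
    qed
    hence "c * (b x)\<^sup>2 = (2 * c + s * c\<^sup>2 - \<sigma> * c\<^sup>2) * (b x)\<^sup>2" by simp
    thus ?thesis unfolding quad' split by (simp add: algebra_simps power2_eq_square)
  qed
  have IH: "(\<integral>\<^sup>+g. ennreal (exp (\<sigma> / 2 * quad n S' g)) \<partial>gauss_prod n) \<le>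
    ennreal (exp (\<sigma> / 2 * (\<Sum>i<n. S' i i) / (1 - \<sigma> * \<kappa>)))"
  proof (rule Suc.IH)
    show "S' i j = S' j i" for i j unfolding S'_def using sym[of i j] by simp
    fix x
    have q0: "quad n S x = quad (Suc n) S (x(n := 0))" unfolding split by simp
    show "0 \<le> quad n S' x"
    proof (cases "\<sigma> = 1")
      case True
      hence "0 \<le> c" using d1 by (simp add: c_def)
      thus ?thesis unfolding quad' q0 by (intro add_nonneg_nonneg mult_nonneg_nonneg psd) auto
    next
      case False
      hence "\<sigma> = -1" using sg by simp
      hence "\<sigma> * (c * b x)\<^sup>2 \<le> 0" by simp
      thus ?thesis unfolding key using psd[of "x(n := c * b x)"] by linarith
    qed
    show "quad n S' x \<le> \<kappa> * (\<Sum>i<n. (x i)\<^sup>2)"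
    proof (cases "\<sigma> = 1")
      case True
      have "quad n S' x \<le> \<kappa> * ((\<Sum>i<n. (x i)\<^sup>2) + (c * b x)\<^sup>2) - (c * b x)\<^sup>2"
        unfolding key True mult_1 using ub[of "x(n := c * b x)"] unfolding sq by linarith
      also have "\<dots> \<le> \<kappa> * (\<Sum>i<n. (x i)\<^sup>2)"
        using k mult_right_mono[of \<kappa> 1 "(c * b x)\<^sup>2"] by (simp add: algebra_simps)
      finally show ?thesis .
    next
      case False
      hence "c \<le> 0" using d1 sg by (simp add: c_def divide_nonpos_pos)
      hence "quad n S' x \<le> quad n S x" unfolding quad' by (simp add: mult_nonpos_nonneg)
      also have "\<dots> \<le> \<kappa> * (\<Sum>i<n. (x i)\<^sup>2)" using ub[of "x(n := 0)"] unfolding sq q0[symmetric] by simp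
      finally show ?thesis .
    qed
  qed
  have int1: "(\<integral>\<^sup>+y. ennreal (exp (\<sigma> / 2 * quad (Suc n) S (x(n := y)))) \<partial>std_normal_distribution) =
      ennreal (1 / sqrt (1 - \<sigma> * s)) * ennreal (exp (\<sigma> / 2 * quad n S' x))" for x
  proof -
    have "exp (\<sigma> / 2 * quad (Suc n) S (x(n := y))) =
        exp (\<sigma> / 2 * quad n S x) * exp ((\<sigma> * b x) * y + (\<sigma> * s) * y\<^sup>2 / 2)" for y
      unfolding split exp_add[symmetric] by (simp add: algebra_simps)
    hence "(\<integral>\<^sup>+y. ennreal (exp (\<sigma> / 2 * quad (Suc n) S (x(n := y)))) \<partial>std_normal_distribution) =
      ennreal (exp (\<sigma> / 2 * quad n S x)) *
        ennreal (exp ((\<sigma> * b x)\<^sup>2 / (2 * (1 - \<sigma> * s))) / sqrt (1 - \<sigma> * s))"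
      using d1 nn_integral_std_normal_exp[of "\<sigma> * s" "\<sigma> * b x"]
      by (simp add: ennreal_mult nn_integral_cmult)
    also have "\<dots> = ennreal (1 / sqrt (1 - \<sigma> * s) *
        exp (\<sigma> / 2 * quad n S x + (\<sigma> * b x)\<^sup>2 / (2 * (1 - \<sigma> * s))))"
      using d1 by (subst ennreal_mult[symmetric]) (auto simp: exp_add mult_ac)
    also have "\<sigma> / 2 * quad n S x + (\<sigma> * b x)\<^sup>2 / (2 * (1 - \<sigma> * s)) = \<sigma> / 2 * quad n S' x"
      unfolding quad' c_def using d1 sg by (auto simp: field_simps power2_eq_square)
    also have "ennreal (1 / sqrt (1 - \<sigma> * s) * exp (\<sigma> / 2 * quad n S' x)) =
        ennreal (1 / sqrt (1 - \<sigma> * s)) * ennreal (exp (\<sigma> / 2 * quad n S' x))"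
      by (rule ennreal_mult) (use d1 in auto)
    finally show ?thesis .
  qed
  have "(\<integral>\<^sup>+g. ennreal (exp (\<sigma> / 2 * quad (Suc n) S g)) \<partial>gauss_prod (Suc n)) =
      (\<integral>\<^sup>+x. (\<integral>\<^sup>+y. ennreal (exp (\<sigma> / 2 * quad (Suc n) S (x(n := y)))) \<partial>std_normal_distribution)
         \<partial>gauss_prod n)"
    unfolding lessThan_Suc
    by (rule product_nn_integral_insert) (auto simp: lessThan_Suc[symmetric])
  also have "\<dots> = ennreal (1 / sqrt (1 - \<sigma> * s)) *
      (\<integral>\<^sup>+x. ennreal (exp (\<sigma> / 2 * quad n S' x)) \<partial>gauss_prod n)"
    unfolding int1 by (rule nn_integral_cmult) simp
  also have "\<dots> \<le> ennreal (1 / sqrt (1 - \<sigma> * s)) *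
      ennreal (exp (\<sigma> / 2 * (\<Sum>i<n. S' i i) / (1 - \<sigma> * \<kappa>)))"
    using IH by (rule mult_left_mono) simp
  also have "\<dots> = ennreal (1 / sqrt (1 - \<sigma> * s) * exp (\<sigma> / 2 * (\<Sum>i<n. S' i i) / (1 - \<sigma> * \<kappa>)))"
    using d1 by (subst ennreal_mult) auto
  also have "\<dots> \<le> ennreal (exp (\<sigma> * s / (2 * (1 - \<sigma> * s))) *
      exp (\<sigma> / 2 * (\<Sum>i<n. S' i i) / (1 - \<sigma> * \<kappa>)))"
    using inverse_sqrt_le_exp[of "\<sigma> * s"] d1 by (intro ennreal_leI mult_right_mono) auto
  also have "\<dots> \<le> ennreal (exp (\<sigma> / 2 * (\<Sum>i<Suc n. S i i) / (1 - \<sigma> * \<kappa>)))"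
    unfolding exp_add[symmetric]
  proof (intro ennreal_leI, subst exp_le_cancel_iff)
    \<comment> \<open>The bounds balance: the last coordinate costs \<sigma> s / (1 - \<sigma> s),
      and the last-column bound on \<open>m\<close> makes the trace increment c m small enough to
      leave room for exactly this cost within the share \<sigma> s / (1 - \<sigma> \<kappa>) of the
      diagonal entry \<open>s\<close>.\<close>
    have tr: "(\<Sum>i<n. S' i i) = (\<Sum>i<n. S i i) + c * m"
      by (simp add: S'_def m_def sum.distrib sum_distrib_left power2_eq_square mult_ac)
    have "\<sigma> * c = 1 / (1 - \<sigma> * s)" unfolding c_def using sg by auto
    hence "\<sigma> * (c * m) = m / (1 - \<sigma> * s)" by (metis mult.assoc mult_1 times_divide_eq_left)
    also have "\<dots> \<le> (\<kappa> * s - s\<^sup>2) / (1 - \<sigma> * s)" using m d1 by (simp add: divide_right_mono)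
    also have "\<dots> = \<sigma> * s - \<sigma> * s * (1 - \<sigma> * \<kappa>) / (1 - \<sigma> * s)"
      using d1 sg by (auto simp: field_simps power2_eq_square)
    finally have "\<sigma> * (c * m) / (1 - \<sigma> * \<kappa>) \<le>
        (\<sigma> * s - \<sigma> * s * (1 - \<sigma> * \<kappa>) / (1 - \<sigma> * s)) / (1 - \<sigma> * \<kappa>)"
      using d1 by (intro divide_right_mono) auto
    also have "\<dots> = \<sigma> * s / (1 - \<sigma> * \<kappa>) - \<sigma> * s / (1 - \<sigma> * s)"
      using d1 by (simp add: diff_divide_distrib)
    finally have *: "\<sigma> * (c * m) / (1 - \<sigma> * \<kappa>) \<le> \<sigma> * s / (1 - \<sigma> * \<kappa>) - \<sigma> * s / (1 - \<sigma> * s)" .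
    have "\<sigma> * s / (2 * (1 - \<sigma> * s)) = (\<sigma> * s / (1 - \<sigma> * s)) / 2" by simp
    moreover have "\<sigma> / 2 * (\<Sum>i<n. S' i i) / (1 - \<sigma> * \<kappa>) =
        \<sigma> / 2 * (\<Sum>i<n. S i i) / (1 - \<sigma> * \<kappa>) + (\<sigma> * (c * m) / (1 - \<sigma> * \<kappa>)) / 2"
      unfolding tr by (simp add: distrib_left add_divide_distrib)
    moreover have "\<sigma> / 2 * (\<Sum>i<Suc n. S i i) / (1 - \<sigma> * \<kappa>) =
        \<sigma> / 2 * (\<Sum>i<n. S i i) / (1 - \<sigma> * \<kappa>) + (\<sigma> * s / (1 - \<sigma> * \<kappa>)) / 2"
      by (simp add: distrib_left add_divide_distrib s_def)
    ultimately show "\<sigma> * s / (2 * (1 - \<sigma> * s)) + \<sigma> / 2 * (\<Sum>i<n. S' i i) / (1 - \<sigma> * \<kappa>) \<le>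
        \<sigma> / 2 * (\<Sum>i<Suc n. S i i) / (1 - \<sigma> * \<kappa>)"
    proof (elim ssubst)
      have "A / 2 + (B + C / 2) \<le> B + D / 2" if "C \<le> D - A" for A B C D :: real
        using that by simp
      thus "\<sigma> * s / (1 - \<sigma> * s) / 2 +
          (\<sigma> / 2 * (\<Sum>i<n. S i i) / (1 - \<sigma> * \<kappa>) + \<sigma> * (c * m) / (1 - \<sigma> * \<kappa>) / 2)
        \<le> \<sigma> / 2 * (\<Sum>i<n. S i i) / (1 - \<sigma> * \<kappa>) + \<sigma> * s / (1 - \<sigma> * \<kappa>) / 2"
        using * .
    qed
  qed
  finally show ?case .
qed

section \<open>Concentration of squared norms of Gaussian vectors\<close>

lemma integrable_mult_of_squares:
  fixes f g :: "'a \<Rightarrow> real"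
  assumes [measurable]: "f \<in> borel_measurable M" "g \<in> borel_measurable M"
    and "integrable M (\<lambda>\<omega>. (f \<omega>)\<^sup>2)" "integrable M (\<lambda>\<omega>. (g \<omega>)\<^sup>2)"
  shows "integrable M (\<lambda>\<omega>. f \<omega> * g \<omega>)"
proof (rule Bochner_Integration.integrable_bound)
  show "integrable M (\<lambda>\<omega>. (f \<omega>)\<^sup>2 + (g \<omega>)\<^sup>2)" using assms by simp
  show "AE \<omega> in M. norm (f \<omega> * g \<omega>) \<le> norm ((f \<omega>)\<^sup>2 + (g \<omega>)\<^sup>2)"
  proof (rule AE_I2)
    fix \<omega>
    have "2 * \<bar>f \<omega> * g \<omega>\<bar> \<le> (f \<omega>)\<^sup>2 + (g \<omega>)\<^sup>2"
      using sum_squares_bound[of "\<bar>f \<omega>\<bar>" "\<bar>g \<omega>\<bar>"] by (simp add: abs_mult)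
    thus "norm (f \<omega> * g \<omega>) \<le> norm ((f \<omega>)\<^sup>2 + (g \<omega>)\<^sup>2)"
      by (simp add: sum_power2_ge_zero)
  qed
qed simp

context prob_space
begin

text \<open>A degenerate Gaussian variable has no density, so each computation of a law below splits
  into these two cases.\<close>

lemma centered_gaussian_rv_cases:
  assumes "gaussian_rv M Z" and "expectation Z = 0"
  obtains "AE \<omega> in M. Z \<omega> = 0"
  | \<sigma> where "\<sigma> > 0" "distributed M lborel Z (normal_density 0 \<sigma>)"
proof -
  have [measurable]: "Z \<in> borel_measurable M" using assms by (simp add: gaussian_rv_def)
  from assms(1) consider \<mu> where "AE \<omega> in M. Z \<omega> = \<mu>"
    | \<mu> \<sigma> where "\<sigma> > 0" "distributed M lborel Z (normal_density \<mu> \<sigma>)"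
    by (auto simp: gaussian_rv_def)
  thus ?thesis
  proof cases
    case 1
    have "expectation Z = expectation (\<lambda>_. \<mu>)" by (rule integral_cong_AE) (use 1 in auto)
    with assms(2) 1 have "AE \<omega> in M. Z \<omega> = 0" by (simp add: prob_space)
    thus ?thesis by (rule that)
  next
    case 2
    hence "\<mu> = 0" using normal_distributed_expectation assms(2) by metis
    with 2 that(2) show ?thesis by blast
  qed
qed

lemma centered_gaussian_square_integrable:
  assumes "gaussian_rv M Z" and "expectation Z = 0"
  shows "integrable M (\<lambda>\<omega>. (Z \<omega>)\<^sup>2)"
  using assms
proof (cases rule: centered_gaussian_rv_cases)
  case 1
  have [measurable]: "Z \<in> borel_measurable M" using assms by (simp add: gaussian_rv_def)
  have "integrable M (\<lambda>\<omega>. (Z \<omega>)\<^sup>2) = integrable M (\<lambda>_. 0 :: real)"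
    by (rule integrable_cong_AE) (use 1 in auto)
  thus ?thesis by simp
next
  case (2 \<sigma>)
  have "integrable lborel (\<lambda>x. normal_density 0 \<sigma> x * x\<^sup>2)"
    using integrable_normal_moment[OF 2(1), of 0 2] by simp
  thus ?thesis using distributed_integrable[OF 2(2), of "\<lambda>x. x\<^sup>2"] by simp
qed

lemma normal_scaled_distr:
  assumes "\<sigma> > 0" "distributed M lborel Z (normal_density 0 \<sigma>)"
  shows "(\<lambda>\<omega>. Z \<omega> / \<sigma>) \<in> borel_measurable M"
    and "distr M lborel (\<lambda>\<omega>. Z \<omega> / \<sigma>) = std_normal_distribution"
    and "expectation (\<lambda>\<omega>. (Z \<omega>)\<^sup>2) = \<sigma>\<^sup>2"
proof -
  have D: "distributed M lborel (\<lambda>\<omega>. Z \<omega> / \<sigma>) std_normal_density"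
    using normal_standard_normal_convert[OF assms(1), of Z 0] assms(2) by simp
  show "(\<lambda>\<omega>. Z \<omega> / \<sigma>) \<in> borel_measurable M"
    using distributed_measurable[OF D] by simp
  show "distr M lborel (\<lambda>\<omega>. Z \<omega> / \<sigma>) = std_normal_distribution"
    using distributed_distr_eq_density[OF D] by simp
  show "expectation (\<lambda>\<omega>. (Z \<omega>)\<^sup>2) = \<sigma>\<^sup>2"
    using normal_distributed_variance[OF assms] normal_distributed_expectation[OF assms] by simp
qed

text \<open>Expressing the exponent by the second moment covers the degenerate case too. The
  nonnegative integral allows Tonelli later without an integrability proof.\<close>

lemma centered_gaussian_mgf:
  assumes "gaussian_rv M Z" and "expectation Z = 0"
  shows "(\<integral>\<^sup>+\<omega>. ennreal (exp (Z \<omega>)) \<partial>M) = ennreal (exp (expectation (\<lambda>\<omega>. (Z \<omega>)\<^sup>2) / 2))"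
  using assms
proof (cases rule: centered_gaussian_rv_cases)
  case 1
  have [measurable]: "Z \<in> borel_measurable M" using assms by (simp add: gaussian_rv_def)
  have "(\<integral>\<^sup>+\<omega>. ennreal (exp (Z \<omega>)) \<partial>M) = (\<integral>\<^sup>+\<omega>. 1 \<partial>M)"
    by (rule nn_integral_cong_AE) (use 1 in auto)
  moreover have "expectation (\<lambda>\<omega>. (Z \<omega>)\<^sup>2) = expectation (\<lambda>_. 0 :: real)"
    by (rule integral_cong_AE) (use 1 in auto)
  ultimately show ?thesis by (simp add: emeasure_space_1)
next
  case (2 \<sigma>)
  note W = normal_scaled_distr[OF 2]
  have "(\<integral>\<^sup>+\<omega>. ennreal (exp (Z \<omega>)) \<partial>M) = (\<integral>\<^sup>+\<omega>. ennreal (exp (\<sigma> * (Z \<omega> / \<sigma>))) \<partial>M)"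
    using 2(1) by simp
  also have "\<dots> = (\<integral>\<^sup>+y. ennreal (exp (\<sigma> * y)) \<partial>distr M lborel (\<lambda>\<omega>. Z \<omega> / \<sigma>))"
    using W(1) by (subst nn_integral_distr) auto
  also have "\<dots> = ennreal (exp (\<sigma>\<^sup>2 / 2))"
    unfolding W(2) using nn_integral_std_normal_exp[of 0 \<sigma>] by simp
  finally show ?thesis by (simp add: W(3))
qed

lemma centered_gaussian_char:
  assumes "gaussian_rv M Z" and "expectation Z = 0"
  shows "(LINT \<omega>|M. iexp (Z \<omega>)) = complex_of_real (exp (- expectation (\<lambda>\<omega>. (Z \<omega>)\<^sup>2) / 2))"
  using assms
proof (cases rule: centered_gaussian_rv_cases)
  case 1
  have [measurable]: "Z \<in> borel_measurable M" using assms by (simp add: gaussian_rv_def)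
  have "(LINT \<omega>|M. iexp (Z \<omega>)) = (LINT \<omega>|M. 1)"
    by (rule integral_cong_AE) (use 1 in auto)
  moreover have "expectation (\<lambda>\<omega>. (Z \<omega>)\<^sup>2) = expectation (\<lambda>_. 0 :: real)"
    by (rule integral_cong_AE) (use 1 in auto)
  ultimately show ?thesis by (simp add: prob_space)
next
  case (2 \<sigma>)
  note W = normal_scaled_distr[OF 2]
  have "(LINT \<omega>|M. iexp (Z \<omega>)) = (LINT \<omega>|M. iexp (\<sigma> * (Z \<omega> / \<sigma>)))"
    using 2(1) by simp
  also have "\<dots> = (LINT y|distr M lborel (\<lambda>\<omega>. Z \<omega> / \<sigma>). iexp (\<sigma> * y))"
    using W(1) by (subst integral_distr) auto
  also have "\<dots> = char std_normal_distribution \<sigma>"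
    unfolding W(2) char_def by simp
  also have "\<dots> = complex_of_real (exp (- \<sigma>\<^sup>2 / 2))" by (simp add: char_std_normal_distribution)
  finally show ?thesis by (simp add: W(3))
qed

end

text \<open>To be read from right to left: the exponential of a square becomes an average of
  exponentials linear in \<open>y\<close>. The factor sqrt (2 * c) turns the exponent t^2 / 2 of the
  Gaussian moment generating function into c times the square of \<open>y j\<close>.\<close>

lemma nn_integral_gauss_prod_exp_linear:
  assumes "c \<ge> 0"
  shows "(\<integral>\<^sup>+g. ennreal (exp (sqrt (2 * c) * (\<Sum>j<N. g j * y j))) \<partial>gauss_prod N) =
    ennreal (exp (c * (\<Sum>j<N. (y j)\<^sup>2)))"
proof -
  interpret product_prob_space "\<lambda>_. std_normal_distribution" "{..<N}"
    by (rule product_prob_space_std_normal)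
  have "(\<integral>\<^sup>+g. ennreal (exp (sqrt (2 * c) * (\<Sum>j<N. g j * y j))) \<partial>gauss_prod N) =
      (\<integral>\<^sup>+g. (\<Prod>j<N. ennreal (exp (sqrt (2 * c) * y j * g j))) \<partial>gauss_prod N)"
    by (simp add: prod_ennreal exp_sum[symmetric] sum_distrib_left mult_ac)
  also have "\<dots> = (\<Prod>j<N. (\<integral>\<^sup>+g. ennreal (exp (sqrt (2 * c) * y j * g)) \<partial>std_normal_distribution))"
    by (rule product_nn_integral_prod) auto
  also have "\<dots> = (\<Prod>j<N. ennreal (exp (c * (y j)\<^sup>2)))"
  proof (rule prod.cong)
    fix j
    show "(\<integral>\<^sup>+g. ennreal (exp (sqrt (2 * c) * y j * g)) \<partial>std_normal_distribution) =
        ennreal (exp (c * (y j)\<^sup>2))"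
      using nn_integral_std_normal_exp[of 0 "sqrt (2 * c) * y j"] assms
      by (simp add: power_mult_distrib)
  qed simp
  also have "\<dots> = ennreal (exp (c * (\<Sum>j<N. (y j)\<^sup>2)))"
    by (simp add: prod_ennreal exp_sum[symmetric] sum_distrib_left)
  finally show ?thesis .
qed

text \<open>Averages of real exponentials of linear forms can only produce a positive quadratic
  exponent; the negative sign comes from characteristic functions.\<close>

lemma integral_gauss_prod_iexp_linear:
  assumes "c \<ge> 0"
  shows "(LINT g|gauss_prod N. iexp (sqrt (2 * c) * (\<Sum>j<N. g j * y j))) =
    complex_of_real (exp (- c * (\<Sum>j<N. (y j)\<^sup>2)))"
proof -
  interpret product_prob_space "\<lambda>_. std_normal_distribution" "{..<N}"
    by (rule product_prob_space_std_normal)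
  have "iexp (sqrt (2 * c) * (\<Sum>j<N. g j * y j)) = (\<Prod>j<N. iexp (sqrt (2 * c) * y j * g j))" for g :: "nat \<Rightarrow> real"
    by (simp add: exp_sum[symmetric] sum_distrib_left mult_ac)
  hence "(LINT g|gauss_prod N. iexp (sqrt (2 * c) * (\<Sum>j<N. g j * y j))) =
      (LINT g|gauss_prod N. (\<Prod>j<N. iexp (sqrt (2 * c) * y j * g j)))" by simp
  also have "\<dots> = (\<Prod>j<N. (LINT g|std_normal_distribution. iexp (sqrt (2 * c) * y j * g)))"
    by (rule product_integral_prod) (auto intro!: finite_measure.integrable_const_bound[OF prob_space.finite_measure[OF prob_space_std_normal], of _ 1])
  also have "\<dots> = (\<Prod>j<N. complex_of_real (exp (- c * (y j)\<^sup>2)))"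
  proof (rule prod.cong)
    fix j
    have "(LINT g|std_normal_distribution. iexp (sqrt (2 * c) * y j * g)) =
        char std_normal_distribution (sqrt (2 * c) * y j)"
      by (simp add: char_def)
    also have "\<dots> = complex_of_real (exp (- (sqrt (2 * c) * y j)\<^sup>2 / 2))"
      unfolding char_std_normal_distribution ..
    also have "- (sqrt (2 * c) * y j)\<^sup>2 / 2 = - c * (y j)\<^sup>2"
      using assms by (simp add: power_mult_distrib)
    finally show "(LINT g|std_normal_distribution. iexp (sqrt (2 * c) * y j * g)) =
        complex_of_real (exp (- c * (y j)\<^sup>2))" .
  qed simp
  also have "\<dots> = complex_of_real (exp (- c * (\<Sum>j<N. (y j)\<^sup>2)))"
    by (simp add: exp_sum[symmetric] sum_distrib_left sum_negf of_real_prod[symmetric] del: of_real_prod)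
  finally show ?thesis .
qed

text \<open>Joint Gaussianity is encoded by all one-dimensional projections, as in the Cramer-Wold
  device. This admits singular covariances and is the form that the linearised exponential moments
  require.\<close>

definition centered_gaussian_vector :: "'a measure \<Rightarrow> nat \<Rightarrow> (nat \<Rightarrow> 'a \<Rightarrow> real) \<Rightarrow> bool" where
  "centered_gaussian_vector M N Y \<longleftrightarrow>
     (\<forall>g. gaussian_rv M (\<lambda>\<omega>. \<Sum>j<N. g j * Y j \<omega>) \<and> (LINT \<omega>|M. (\<Sum>j<N. g j * Y j \<omega>)) = 0)"

section \<open>Exponential moments and tail bounds for Gaussian vectors\<close>

context prob_space
begin

context
  fixes N Y
  assumes Y: "centered_gaussian_vector M N Y"
begin

lemma gaussian_vector_component:
  assumes "j < N" shows "gaussian_rv M (Y j)" "expectation (Y j) = 0"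
proof -
  have "(\<Sum>i<N. (if i = j then 1 else 0) * Y i \<omega>) = (\<Sum>i<N. if i = j then Y i \<omega> else 0)" for \<omega>
    by (rule sum.cong) auto
  hence eq: "(\<lambda>\<omega>. \<Sum>i<N. (if i = j then 1 else 0) * Y i \<omega>) = Y j"
    using assms by auto
  have "gaussian_rv M (\<lambda>\<omega>. \<Sum>i<N. (if i = j then 1 else 0) * Y i \<omega>) \<and>
      expectation (\<lambda>\<omega>. \<Sum>i<N. (if i = j then 1 else 0) * Y i \<omega>) = 0"
    by (rule Y[unfolded centered_gaussian_vector_def, rule_format])
  thus "gaussian_rv M (Y j)" "expectation (Y j) = 0" unfolding eq by auto
qed

lemma gaussian_vector_measurable: "j < N \<Longrightarrow> Y j \<in> borel_measurable M"
  using gaussian_vector_component by (auto simp: gaussian_rv_def)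

lemma gaussian_vector_integrable_mult:
  assumes "i < N" "j < N" shows "integrable M (\<lambda>\<omega>. Y i \<omega> * Y j \<omega>)"
  using assms by (intro integrable_mult_of_squares gaussian_vector_measurable
    centered_gaussian_square_integrable gaussian_vector_component)

text \<open>Besides supplying the variances of the projections, this shows that the covariance form
  is nonnegative.\<close>

lemma quad_covariance:
  "quad N (\<lambda>i j. expectation (\<lambda>\<omega>. Y i \<omega> * Y j \<omega>)) g = expectation (\<lambda>\<omega>. (\<Sum>j<N. g j * Y j \<omega>)\<^sup>2)"
proof -
  have "expectation (\<lambda>\<omega>. (\<Sum>j<N. g j * Y j \<omega>)\<^sup>2) =
      expectation (\<lambda>\<omega>. \<Sum>i<N. \<Sum>j<N. (g i * g j) * (Y i \<omega> * Y j \<omega>))"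
    by (simp add: power2_eq_square sum_product mult_ac)
  also have "\<dots> = (\<Sum>i<N. expectation (\<lambda>\<omega>. \<Sum>j<N. (g i * g j) * (Y i \<omega> * Y j \<omega>)))"
    by (rule Bochner_Integration.integral_sum) (auto intro!: gaussian_vector_integrable_mult)
  also have "\<dots> = (\<Sum>i<N. \<Sum>j<N. expectation (\<lambda>\<omega>. (g i * g j) * (Y i \<omega> * Y j \<omega>)))"
    by (intro sum.cong refl Bochner_Integration.integral_sum) (auto intro!: gaussian_vector_integrable_mult)
  also have "\<dots> = (\<Sum>i<N. \<Sum>j<N. (g i * g j) * expectation (\<lambda>\<omega>. Y i \<omega> * Y j \<omega>))"
    by simp
  finally show ?thesis by (simp add: quad_def mult_ac)
qed

lemma gaussian_vector_sum_measurable: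
  "(\<lambda>(\<omega>, g). \<Sum>j<N. g j * Y j \<omega>) \<in> borel_measurable (M \<Otimes>\<^sub>M gauss_prod N)"
proof -
  have "(\<lambda>p. snd p j * Y j (fst p)) \<in> borel_measurable (M \<Otimes>\<^sub>M gauss_prod N)" if "j < N" for j
  proof (rule borel_measurable_times)
    have "(\<lambda>x. x j) \<in> borel_measurable (gauss_prod N)"
      using measurable_component_singleton[of j "{..<N}" "\<lambda>_. std_normal_distribution"] that
      by (simp cong: measurable_cong_sets)
    thus "(\<lambda>p. snd p j) \<in> borel_measurable (M \<Otimes>\<^sub>M gauss_prod N)"
      by (rule measurable_compose[OF measurable_snd])
    show "(\<lambda>p. Y j (fst p)) \<in> borel_measurable (M \<Otimes>\<^sub>M gauss_prod N)"
      by (rule measurable_compose[OF measurable_fst gaussian_vector_measurable[OF that]])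
  qed
  thus ?thesis unfolding case_prod_beta by (intro borel_measurable_sum) auto
qed

text \<open>Hubbard--Stratonovich: linearising the square with an independent standard Gaussian vector
  reduces both exponential moments to the one-dimensional marginals of \<open>Y\<close>.\<close>

lemma nn_integral_exp_sum_squares:
  assumes l: "l \<ge> 0" and sg: "\<sigma> = 1 \<or> \<sigma> = - 1"
  defines "S \<equiv> (\<lambda>i j. 2 * l * expectation (\<lambda>\<omega>. Y i \<omega> * Y j \<omega>))"
  shows "(\<integral>\<^sup>+\<omega>. ennreal (exp (\<sigma> * l * (\<Sum>j<N. (Y j \<omega>)\<^sup>2))) \<partial>M) =
    (\<integral>\<^sup>+g. ennreal (exp (\<sigma> / 2 * quad N S g)) \<partial>gauss_prod N)"
proof -
  interpret G: product_prob_space "\<lambda>_. std_normal_distribution" "{..<N}"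
    by (rule product_prob_space_std_normal)
  interpret P: pair_prob_space M "gauss_prod N" ..
  define t where "t = sqrt (2 * l)"
  have t2: "t\<^sup>2 = 2 * l" using l by (simp add: t_def)
  note [measurable] = gaussian_vector_sum_measurable
  have lin: "gaussian_rv M (\<lambda>\<omega>. t * (\<Sum>j<N. g j * Y j \<omega>))"
      "expectation (\<lambda>\<omega>. t * (\<Sum>j<N. g j * Y j \<omega>)) = 0"
      "expectation (\<lambda>\<omega>. (t * (\<Sum>j<N. g j * Y j \<omega>))\<^sup>2) = quad N S g" for g
  proof -
    have "gaussian_rv M (\<lambda>\<omega>. \<Sum>j<N. (t * g j) * Y j \<omega>)"
      "expectation (\<lambda>\<omega>. \<Sum>j<N. (t * g j) * Y j \<omega>) = 0"
      using Y[unfolded centered_gaussian_vector_def, rule_format, of "\<lambda>j. t * g j"] by auto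
    thus "gaussian_rv M (\<lambda>\<omega>. t * (\<Sum>j<N. g j * Y j \<omega>))"
      "expectation (\<lambda>\<omega>. t * (\<Sum>j<N. g j * Y j \<omega>)) = 0"
      by (simp_all only: sum_distrib_left mult.assoc)
    have "quad N S g = 2 * l * quad N (\<lambda>i j. expectation (\<lambda>\<omega>. Y i \<omega> * Y j \<omega>)) g"
      unfolding quad_def S_def by (simp add: sum_distrib_left mult_ac)
    thus "expectation (\<lambda>\<omega>. (t * (\<Sum>j<N. g j * Y j \<omega>))\<^sup>2) = quad N S g"
      by (simp add: quad_covariance power_mult_distrib t2)
  qed
  have Qm: "(\<lambda>\<omega>. \<Sum>j<N. (Y j \<omega>)\<^sup>2) \<in> borel_measurable M"
    using gaussian_vector_measurable by (intro borel_measurable_sum borel_measurable_power) auto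
  show ?thesis
  proof (cases "\<sigma> = 1")
    case True
    have "(\<integral>\<^sup>+\<omega>. ennreal (exp (l * (\<Sum>j<N. (Y j \<omega>)\<^sup>2))) \<partial>M) =
        (\<integral>\<^sup>+\<omega>. (\<integral>\<^sup>+g. ennreal (exp (t * (\<Sum>j<N. g j * Y j \<omega>))) \<partial>gauss_prod N) \<partial>M)"
      unfolding t_def nn_integral_gauss_prod_exp_linear[OF l] ..
    also have "\<dots> = (\<integral>\<^sup>+g. (\<integral>\<^sup>+\<omega>. ennreal (exp (t * (\<Sum>j<N. g j * Y j \<omega>))) \<partial>M) \<partial>gauss_prod N)"
      by (rule P.Fubini'[symmetric]) measurable
    also have "\<dots> = (\<integral>\<^sup>+g. ennreal (exp (quad N S g / 2)) \<partial>gauss_prod N)"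
      using centered_gaussian_mgf[OF lin(1,2)] lin(3) by simp
    finally show ?thesis using True by simp
  next
    case False
    hence sg': "\<sigma> = -1" using sg by simp
    have nn: "0 \<le> quad N S g" for g unfolding lin(3)[symmetric] by simp
    \<comment> \<open>The linearised integrand is now complex, so Tonelli gives way to the Fubini
      theorem for integrable functions; integrability holds because \<open>iexp\<close> has modulus
      one. Both final integrands are bounded by 1, which allows the return to nonnegative
      integrals.\<close>
    have "complex_of_real (LINT \<omega>|M. exp (- l * (\<Sum>j<N. (Y j \<omega>)\<^sup>2))) =
        (LINT \<omega>|M. complex_of_real (exp (- l * (\<Sum>j<N. (Y j \<omega>)\<^sup>2))))"
      by simp
    also have "\<dots> = (LINT \<omega>|M. (LINT g|gauss_prod N. iexp (t * (\<Sum>j<N. g j * Y j \<omega>))))"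
      unfolding t_def integral_gauss_prod_iexp_linear[OF l] ..
    also have "\<dots> = (LINT g|gauss_prod N. (LINT \<omega>|M. iexp (t * (\<Sum>j<N. g j * Y j \<omega>))))"
    proof (rule P.Fubini_integral[symmetric])
      show "integrable (M \<Otimes>\<^sub>M gauss_prod N) (\<lambda>(\<omega>, g). iexp (t * (\<Sum>j<N. g j * Y j \<omega>)))"
      proof (rule P.integrable_const_bound[of _ 1])
        have "(\<lambda>p. iexp (t * (case p of (\<omega>, g) \<Rightarrow> \<Sum>j<N. g j * Y j \<omega>)))
            \<in> borel_measurable (M \<Otimes>\<^sub>M gauss_prod N)"
          by measurable
        thus "(\<lambda>(\<omega>, g). iexp (t * (\<Sum>j<N. g j * Y j \<omega>))) \<in> borel_measurable (M \<Otimes>\<^sub>M gauss_prod N)"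
          unfolding case_prod_beta .
      qed (auto simp: case_prod_beta simp del: of_real_mult of_real_sum)
    qed
    also have "\<dots> = (LINT g|gauss_prod N. complex_of_real (exp (- quad N S g / 2)))"
      unfolding centered_gaussian_char[OF lin(1,2)] lin(3) ..
    also have "\<dots> = complex_of_real (LINT g|gauss_prod N. exp (- quad N S g / 2))" by simp
    finally have eq: "(LINT \<omega>|M. exp (- l * (\<Sum>j<N. (Y j \<omega>)\<^sup>2))) =
        (LINT g|gauss_prod N. exp (- quad N S g / 2))"
      by (simp only: of_real_eq_iff)
    have "(\<integral>\<^sup>+\<omega>. ennreal (exp (- l * (\<Sum>j<N. (Y j \<omega>)\<^sup>2))) \<partial>M) =
        ennreal (LINT \<omega>|M. exp (- l * (\<Sum>j<N. (Y j \<omega>)\<^sup>2)))"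
      using Qm l by (intro nn_integral_eq_integral integrable_const_bound[of _ 1])
        (auto intro!: mult_nonneg_nonneg sum_nonneg)
    moreover have "(\<integral>\<^sup>+g. ennreal (exp (- quad N S g / 2)) \<partial>gauss_prod N) =
        ennreal (LINT g|gauss_prod N. exp (- quad N S g / 2))"
      using nn by (intro nn_integral_eq_integral finite_measure.integrable_const_bound[OF
          prob_space.finite_measure[OF prob_space_PiM[OF prob_space_std_normal]], of _ 1]) auto
    ultimately show ?thesis using eq sg' by simp
  qed
qed

text \<open>For S = 2 l R one has \<kappa> = 2 l r, and half the trace of S is l T. The assumption l
  r \<le> 1/4 says \<kappa> \<le> 1/2, where \<sigma> / (1 - \<sigma> \<kappa>) \<le> \<sigma> + 2
  \<kappa>; multiplying by l T gives the mean term and the error 4 l^2 r T.\<close>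

lemma exp_moment_sum_squares_le:
  assumes l: "l > 0" and r: "r > 0" and lr: "l * r \<le> 1 / 4" and sg: "\<sigma> = 1 \<or> \<sigma> = - 1"
    and ub: "\<And>x. quad N (\<lambda>i j. expectation (\<lambda>\<omega>. Y i \<omega> * Y j \<omega>)) x \<le> r * (\<Sum>i<N. (x i)\<^sup>2)"
    and T: "T = (\<Sum>j<N. expectation (\<lambda>\<omega>. (Y j \<omega>)\<^sup>2))"
  shows "(\<integral>\<^sup>+\<omega>. ennreal (exp (\<sigma> * l * (\<Sum>j<N. (Y j \<omega>)\<^sup>2))) \<partial>M) \<le>
    ennreal (exp (\<sigma> * l * T + 4 * l\<^sup>2 * r * T))"
proof -
  define R where "R = (\<lambda>i j. expectation (\<lambda>\<omega>. Y i \<omega> * Y j \<omega>))"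
  define S where "S = (\<lambda>i j. 2 * l * R i j)"
  define \<kappa> where "\<kappa> = 2 * l * r"
  have k: "0 < \<kappa>" "\<kappa> \<le> 1 / 2" using l r lr by (auto simp: \<kappa>_def)
  have T0: "T \<ge> 0" unfolding T by (intro sum_nonneg) simp
  have quadS: "quad N S x = 2 * l * quad N R x" for x
    unfolding quad_def S_def by (simp add: sum_distrib_left mult_ac)
  have tr: "(\<Sum>i<N. S i i) = 2 * l * T"
    unfolding T S_def R_def by (simp add: sum_distrib_left power2_eq_square)
  have "(\<integral>\<^sup>+\<omega>. ennreal (exp (\<sigma> * l * (\<Sum>j<N. (Y j \<omega>)\<^sup>2))) \<partial>M) \<le>
      ennreal (exp (\<sigma> / 2 * (\<Sum>i<N. S i i) / (1 - \<sigma> * \<kappa>)))"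
    unfolding nn_integral_exp_sum_squares[OF less_imp_le[OF l] sg] S_def[unfolded R_def, symmetric]
  proof (rule nn_integral_exp_quad_le)
    show "S i j = S j i" for i j by (simp add: S_def R_def mult.commute)
    show "0 < \<kappa>" "\<kappa> < 1" using k by auto
    show "0 \<le> quad N S x" for x
      unfolding quadS using l by (simp add: R_def quad_covariance)
    show "quad N S x \<le> \<kappa> * (\<Sum>i<N. (x i)\<^sup>2)" for x
      unfolding quadS \<kappa>_def using ub[of x] l by (simp add: R_def)
  qed (rule sg)
  also have "\<sigma> / 2 * (\<Sum>i<N. S i i) / (1 - \<sigma> * \<kappa>) = (l * T) * (\<sigma> / (1 - \<sigma> * \<kappa>))"
    unfolding tr by simp
  also have "ennreal (exp ((l * T) * (\<sigma> / (1 - \<sigma> * \<kappa>)))) \<le> ennreal (exp ((l * T) * (\<sigma> + 2 * \<kappa>)))"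
  proof (intro ennreal_leI, subst exp_le_cancel_iff, rule mult_left_mono)
    have "\<kappa> * (2 * \<kappa>) \<le> \<kappa> * 1" using k by (intro mult_left_mono) auto
    hence "0 \<le> \<kappa> - 2 * \<kappa>\<^sup>2" by (simp add: power2_eq_square)
    thus "\<sigma> / (1 - \<sigma> * \<kappa>) \<le> \<sigma> + 2 * \<kappa>"
      using sg k by (auto simp: field_simps power2_eq_square)
    show "0 \<le> l * T" using l T0 by simp
  qed
  also have "(l * T) * (\<sigma> + 2 * \<kappa>) = \<sigma> * l * T + 4 * l\<^sup>2 * r * T"
    by (simp add: \<kappa>_def power2_eq_square algebra_simps)
  finally show ?thesis .
qed

text \<open>Chernoff bound for both tails, one for each sign \<sigma>. The parameter l is not
  optimised, since the strong law below fixes it as a power of n.\<close>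

lemma sum_squares_concentration:
  assumes l: "l > 0" and r: "r > 0" and lr: "l * r \<le> 1 / 4"
    and ub: "\<And>x. quad N (\<lambda>i j. expectation (\<lambda>\<omega>. Y i \<omega> * Y j \<omega>)) x \<le> r * (\<Sum>i<N. (x i)\<^sup>2)"
    and T: "T = (\<Sum>j<N. expectation (\<lambda>\<omega>. (Y j \<omega>)\<^sup>2))"
  shows "prob {\<omega> \<in> space M. \<bar>(\<Sum>j<N. (Y j \<omega>)\<^sup>2) - T\<bar> \<ge> s} \<le> 2 * exp (4 * l\<^sup>2 * r * T - l * s)"
proof -
  define Q where "Q = (\<lambda>\<omega>. \<Sum>j<N. (Y j \<omega>)\<^sup>2)"
  have [measurable]: "Q \<in> borel_measurable M"
    using gaussian_vector_measurable unfolding Q_def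
    by (intro borel_measurable_sum borel_measurable_power) auto
  have one: "prob {\<omega> \<in> space M. \<sigma> * (Q \<omega> - T) \<ge> s} \<le> exp (4 * l\<^sup>2 * r * T - l * s)"
    if sg: "\<sigma> = 1 \<or> \<sigma> = - 1" for \<sigma> :: real
  proof -
    have "ennreal (prob {\<omega> \<in> space M. \<sigma> * (Q \<omega> - T) \<ge> s}) =
        emeasure M {\<omega> \<in> space M. 1 \<le> ennreal (exp (- \<sigma> * l * T - l * s)) * ennreal (exp (\<sigma> * l * Q \<omega>))}"
    proof -
      have "(1 \<le> ennreal (exp (- \<sigma> * l * T - l * s)) * ennreal (exp (\<sigma> * l * Q \<omega>))) \<longleftrightarrow>
          \<sigma> * (Q \<omega> - T) \<ge> s" for \<omega>
      proof -
        have "ennreal (exp (- \<sigma> * l * T - l * s)) * ennreal (exp (\<sigma> * l * Q \<omega>)) =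
            ennreal (exp (l * (\<sigma> * (Q \<omega> - T) - s)))"
          by (simp add: ennreal_mult[symmetric] exp_add[symmetric] algebra_simps)
        moreover have "1 \<le> ennreal (exp z) \<longleftrightarrow> 0 \<le> z" for z
          by (metis ennreal_1 ennreal_le_iff exp_ge_zero one_le_exp_iff)
        ultimately show ?thesis using l by (simp add: zero_le_mult_iff)
      qed
      thus ?thesis by (simp add: emeasure_eq_measure)
    qed
    also have "\<dots> \<le> ennreal (exp (- \<sigma> * l * T - l * s)) *
        (\<integral>\<^sup>+\<omega>. ennreal (exp (\<sigma> * l * Q \<omega>)) * indicator (space M) \<omega> \<partial>M)"
      by (rule nn_integral_Markov_inequality) auto
    also have "\<dots> \<le> ennreal (exp (- \<sigma> * l * T - l * s)) * ennreal (exp (\<sigma> * l * T + 4 * l\<^sup>2 * r * T))"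
      using exp_moment_sum_squares_le[OF l r lr sg ub T] by (intro mult_left_mono) (auto simp: Q_def)
    also have "\<dots> = ennreal (exp (4 * l\<^sup>2 * r * T - l * s))"
      by (simp add: ennreal_mult[symmetric] exp_add[symmetric])
    finally show ?thesis by simp
  qed
  have "prob {\<omega> \<in> space M. \<bar>Q \<omega> - T\<bar> \<ge> s} \<le>
      prob ({\<omega> \<in> space M. 1 * (Q \<omega> - T) \<ge> s} \<union> {\<omega> \<in> space M. (- 1) * (Q \<omega> - T) \<ge> s})"
    by (rule finite_measure_mono) auto
  also have "\<dots> \<le> prob {\<omega> \<in> space M. 1 * (Q \<omega> - T) \<ge> s} + prob {\<omega> \<in> space M. (- 1) * (Q \<omega> - T) \<ge> s}"
    by (rule measure_Un_le) auto
  also have "\<dots> \<le> 2 * exp (4 * l\<^sup>2 * r * T - l * s)"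
    using one[of 1] one[of "-1"] by simp
  finally show ?thesis by (simp add: Q_def)
qed

end
end

section \<open>A strong law for Gaussian arrays and the autocovariance of filters\<close>

text \<open>Schur test: 2 |x_i x_j| \<le> x_i^2 + x_j^2 weighted by |R i j|, the two halves being
  equal by symmetry. It stands in for the operator norm.\<close>

lemma quad_le_row_sum:
  assumes sym: "\<And>i j. R i j = R j i" and row: "\<And>i. i < N \<Longrightarrow> (\<Sum>j<N. \<bar>R i j\<bar>) \<le> r"
  shows "quad N R x \<le> r * (\<Sum>i<N. (x i)\<^sup>2)"
proof -
  have "quad N R x \<le> (\<Sum>i<N. \<Sum>j<N. \<bar>R i j\<bar> * (x i)\<^sup>2 / 2 + \<bar>R j i\<bar> * (x j)\<^sup>2 / 2)"
    unfolding quad_def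
  proof (intro sum_mono)
    fix i j
    have "2 * \<bar>x i * x j\<bar> \<le> (x i)\<^sup>2 + (x j)\<^sup>2"
      using sum_squares_bound[of "\<bar>x i\<bar>" "\<bar>x j\<bar>"] by (simp add: abs_mult)
    hence "\<bar>R i j\<bar> * (2 * \<bar>x i * x j\<bar>) \<le> \<bar>R i j\<bar> * ((x i)\<^sup>2 + (x j)\<^sup>2)" by (intro mult_left_mono) auto
    moreover have "R i j * x i * x j \<le> \<bar>R i j\<bar> * \<bar>x i * x j\<bar>"
      by (metis abs_ge_self abs_mult mult.assoc)
    ultimately show "R i j * x i * x j \<le> \<bar>R i j\<bar> * (x i)\<^sup>2 / 2 + \<bar>R j i\<bar> * (x j)\<^sup>2 / 2"
      using sym[of j i] by (simp add: distrib_left)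
  qed
  also have "\<dots> = (\<Sum>i<N. \<Sum>j<N. \<bar>R i j\<bar> * (x i)\<^sup>2 / 2) + (\<Sum>i<N. \<Sum>j<N. \<bar>R j i\<bar> * (x j)\<^sup>2 / 2)"
    by (simp add: sum.distrib)
  also have "(\<Sum>i<N. \<Sum>j<N. \<bar>R j i\<bar> * (x j)\<^sup>2 / 2) = (\<Sum>i<N. \<Sum>j<N. \<bar>R i j\<bar> * (x i)\<^sup>2 / 2)"
    by (rule sum.swap)
  also have "(\<Sum>i<N. \<Sum>j<N. \<bar>R i j\<bar> * (x i)\<^sup>2 / 2) + (\<Sum>i<N. \<Sum>j<N. \<bar>R i j\<bar> * (x i)\<^sup>2 / 2) =
      (\<Sum>i<N. (\<Sum>j<N. \<bar>R i j\<bar>) * (x i)\<^sup>2)"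
    by (simp add: sum_distrib_right sum.distrib[symmetric])
  also have "\<dots> \<le> (\<Sum>i<N. r * (x i)\<^sup>2)" by (intro sum_mono mult_right_mono row) auto
  finally show ?thesis by (simp add: sum_distrib_left)
qed

lemma summable_exp_neg_powr:
  assumes "c > 0" shows "summable (\<lambda>n. exp (- (real n powr c)))"
proof (rule summable_comparison_test_ev)
  have "eventually (\<lambda>n. exp (- (real n powr c)) \<le> 1 / real n ^ 2) at_top"
    using assms by real_asymp
  thus "eventually (\<lambda>n. norm (exp (- (real n powr c))) \<le> 1 / real n ^ 2) at_top" by simp
  show "summable (\<lambda>n. 1 / real n ^ 2)" using inverse_power_summable[of 2, where 'a = real]
    by (simp add: inverse_eq_divide)
qed

text \<open>Nothing is assumed about the joint law of different rows. The centring carries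
  \<open>N n\<close> because row n has only \<open>N n\<close> entries, whereas the sum is divided
  by n.\<close>

lemma (in prob_space) gaussian_array_strong_law:
  fixes Y :: "nat \<Rightarrow> nat \<Rightarrow> 'a \<Rightarrow> real"
  assumes N: "\<And>n. N n \<le> n" and C: "C > 0" and b: "b > 0"
    and Y: "\<And>n. n \<ge> 1 \<Longrightarrow> centered_gaussian_vector M (N n) (Y n)"
    and var: "\<And>n j. n \<ge> 1 \<Longrightarrow> j < N n \<Longrightarrow> expectation (\<lambda>\<omega>. (Y n j \<omega>)\<^sup>2) = q"
    and row: "\<And>n i. n \<ge> 1 \<Longrightarrow> i < N n \<Longrightarrow>
      (\<Sum>j<N n. \<bar>expectation (\<lambda>\<omega>. Y n i \<omega> * Y n j \<omega>)\<bar>) \<le> C * real n powr (1 - b)"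
  shows "AE \<omega> in M. (\<lambda>n. (\<Sum>j<N n. (Y n j \<omega>)\<^sup>2) / real n - real (N n) * q / real n) \<longlonglongrightarrow> 0"
proof -
  define Q where "Q = (\<lambda>n \<omega>. \<Sum>j<N n. (Y n j \<omega>)\<^sup>2)"
  \<comment> \<open>The hypotheses concern rows n \<ge> 1 only; the empty event for n = 0 keeps
    every \<open>A n\<close> measurable, as Borel-Cantelli demands.\<close>
  define A where "A = (\<lambda>n. if n = 0 then {} else
    {\<omega> \<in> space M. \<bar>Q n \<omega> - real (N n) * q\<bar> \<ge> real n powr (1 - b / 4)})"
  have Qm [measurable]: "Q n \<in> borel_measurable M" if "n \<ge> 1" for n
    unfolding Q_def using gaussian_vector_measurable[OF Y[OF that]]
    by (intro borel_measurable_sum borel_measurable_power) auto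
  have Am: "A n \<in> sets M" for n
  proof (cases "n = 0")
    case False
    hence [measurable]: "Q n \<in> borel_measurable M" using Qm by simp
    show ?thesis using False unfolding A_def by simp
  qed (simp add: A_def)
  have "eventually (\<lambda>n. C * real n powr (- b / 2) \<le> 1 / 4) at_top"
    using b by real_asymp
  hence "eventually (\<lambda>n. prob (A n) \<le> 2 * exp (4 * C * \<bar>q\<bar>) * exp (- (real n powr (b / 4)))) at_top"
    using eventually_ge_at_top[of 1]
  proof eventually_elim
    case (elim n)
    \<comment> \<open>With this power, l r = C n^(-b/2) is eventually at most 1/4, l^2 r n = C keeps
      the error term bounded, and l n^(1 - b/4) = n^(b/4) still tends to infinity.\<close>
    define l where "l = real n powr (- 1 + b / 2)"
    define r where "r = C * real n powr (1 - b)"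
    define T where "T = (\<Sum>j<N n. expectation (\<lambda>\<omega>. (Y n j \<omega>)\<^sup>2))"
    have T: "T = real (N n) * q" unfolding T_def using var[OF elim(2)] by simp
    have n0: "real n > 0" using elim by simp
    have lr: "l * r = C * real n powr (- b / 2)"
      unfolding l_def r_def using powr_add[of "real n" "- 1 + b / 2" "1 - b"] by (simp add: mult_ac)
    have "prob (A n) \<le> 2 * exp (4 * l\<^sup>2 * r * T - l * real n powr (1 - b / 4))"
    proof -
      have "prob {\<omega> \<in> space M. \<bar>(\<Sum>j<N n. (Y n j \<omega>)\<^sup>2) - T\<bar> \<ge> real n powr (1 - b / 4)} \<le>
          2 * exp (4 * l\<^sup>2 * r * T - l * real n powr (1 - b / 4))"
      proof (rule sum_squares_concentration[OF Y[OF elim(2)] _ _ _ _ T_def])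
        show "l > 0" "r > 0" using n0 C by (auto simp: l_def r_def)
        show "l * r \<le> 1 / 4" unfolding lr using elim(1) .
        show "quad (N n) (\<lambda>i j. expectation (\<lambda>\<omega>. Y n i \<omega> * Y n j \<omega>)) x \<le> r * (\<Sum>i<N n. (x i)\<^sup>2)" for x
          using row[OF elim(2)] unfolding r_def by (intro quad_le_row_sum) (auto simp: mult.commute)
      qed
      thus ?thesis using elim(2) by (simp add: A_def Q_def T)
    qed
    also have "l * real n powr (1 - b / 4) = real n powr (b / 4)"
      unfolding l_def powr_add[symmetric] by simp
    also have "4 * l\<^sup>2 * r * T \<le> 4 * C * \<bar>q\<bar>"
    proof -
      have "l\<^sup>2 * r * real n = C"
      proof -
        have "l\<^sup>2 * r * real n = C * (real n powr (- 1 + b / 2) * real n powr (- 1 + b / 2) *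
            real n powr (1 - b) * real n powr 1)"
          using n0 by (simp add: l_def r_def power2_eq_square)
        also have "\<dots> = C" unfolding powr_add[symmetric] using n0 by simp
        finally show ?thesis .
      qed
      moreover have "T \<le> real n * \<bar>q\<bar>"
        unfolding T using N[of n] by (intro order.trans[OF mult_left_mono[of q "\<bar>q\<bar>"]] mult_right_mono) auto
      hence "l\<^sup>2 * r * T \<le> l\<^sup>2 * r * (real n * \<bar>q\<bar>)"
        using C by (intro mult_left_mono) (auto simp: r_def)
      ultimately show ?thesis by (metis mult.assoc mult_left_mono zero_le_numeral)
    qed
    finally show ?case by (simp add: exp_diff exp_minus field_simps)
  qed
  hence sm: "summable (\<lambda>n. prob (A n))"
    by (intro summable_comparison_test_ev[OF _ summable_mult[OF summable_exp_neg_powr[of "b / 4"]]])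
      (use b in auto)
  have "AE \<omega> in M. eventually (\<lambda>n. \<omega> \<in> space M - A n) sequentially"
    by (rule borel_cantelli_AE1[OF Am _ sm]) (simp add: emeasure_eq_measure)
  thus ?thesis
  proof (rule AE_mp, intro AE_I2 impI)
    fix \<omega> assume "\<omega> \<in> space M" and ev: "eventually (\<lambda>n. \<omega> \<in> space M - A n) sequentially"
    have "eventually (\<lambda>n. norm (Q n \<omega> / real n - real (N n) * q / real n) \<le> real n powr (- b / 4)) at_top"
      using ev eventually_ge_at_top[of 1]
    proof eventually_elim
      case (elim n)
      hence "\<bar>Q n \<omega> - real (N n) * q\<bar> \<le> real n powr (1 - b / 4)" by (auto simp: A_def)
      hence "\<bar>Q n \<omega> - real (N n) * q\<bar> / real n \<le> real n powr (1 - b / 4) / real n"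
        by (intro divide_right_mono) auto
      also have "\<dots> = real n powr (- b / 4)"
        using elim powr_diff[of "real n" "1 - b / 4" 1] by simp
      finally show ?case by (simp add: diff_divide_distrib[symmetric])
    qed
    moreover have "(\<lambda>n. real n powr (- b / 4)) \<longlonglongrightarrow> 0" using b by real_asymp
    ultimately show "(\<lambda>n. (\<Sum>j<N n. (Y n j \<omega>)\<^sup>2) / real n - real (N n) * q / real n) \<longlonglongrightarrow> 0"
      unfolding Q_def by (rule Lim_null_comparison)
  qed
qed

text \<open>By self-similarity, the autocovariance at lag \<open>k\<close> of the filtered fractional Brownian increments
  at unit mesh, with \<open>h = 2 * H\<close>.\<close>

definition filter_acf :: "real list \<Rightarrow> real \<Rightarrow> real \<Rightarrow> real" where
  "filter_acf a h k = - 1 / 2 * (\<Sum>i<length a. \<Sum>l<length a. a ! i * a ! l * \<bar>k + real i - real l\<bar> powr h)"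

lemma filter_acf_minus: "filter_acf a h (- k) = filter_acf a h k"
proof -
  have "(\<Sum>i<length a. \<Sum>l<length a. a ! i * a ! l * \<bar>- k + real i - real l\<bar> powr h) =
      (\<Sum>l<length a. \<Sum>i<length a. a ! i * a ! l * \<bar>- k + real i - real l\<bar> powr h)"
    by (rule sum.swap)
  also have "\<dots> = (\<Sum>i<length a. \<Sum>l<length a. a ! i * a ! l * \<bar>k + real i - real l\<bar> powr h)"
  proof (intro sum.cong refl)
    fix i l
    have "\<bar>- k + real l - real i\<bar> = \<bar>k + real i - real l\<bar>" by linarith
    thus "a ! l * a ! i * \<bar>- k + real l - real i\<bar> powr h = a ! i * a ! l * \<bar>k + real i - real l\<bar> powr h"
      by simp
  qed
  finally show ?thesis by (simp add: filter_acf_def)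
qed

text \<open>Taylor expansion at k with Lagrange remainder. The condition on m keeps the intermediate
  point above k / 2, where t powr (h - 2) is at most its value at k / 2 because h < 2; moreover |h
  (h - 1) / 2| \<le> 1, so no constant appears.\<close>

lemma powr_second_order_bound:
  fixes k m :: real
  assumes h: "0 < h" "h < 2" and k: "0 < k" and m: "\<bar>m\<bar> \<le> k / 2"
  shows "\<bar>(k + m) powr h - k powr h - h * k powr (h - 1) * m\<bar> \<le> (k / 2) powr (h - 2) * m\<^sup>2"
proof (cases "m = 0")
  case False
  define diff where "diff = (\<lambda>n t :: real. if n = 0 then t powr h else
    if n = (1::nat) then h * t powr (h - 1) else h * (h - 1) * t powr (h - 2))"
  have "\<exists>t. (if k + m < k then k + m < t \<and> t < k else k < t \<and> t < k + m) \<and>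
    (k + m) powr h = (\<Sum>n<2. diff n k / fact n * (k + m - k) ^ n) + diff 2 t / fact 2 * (k + m - k) ^ 2"
  proof (rule Taylor[of 2 diff _ "k / 2" "3 * k / 2"])
    show "diff 0 = (\<lambda>t. t powr h)" by (simp add: diff_def)
    show "\<forall>n t. n < 2 \<and> k / 2 \<le> t \<and> t \<le> 3 * k / 2 \<longrightarrow> (diff n has_real_derivative diff (Suc n) t) (at t)"
    proof (intro allI impI)
      fix n :: nat and t :: real assume "n < 2 \<and> k / 2 \<le> t \<and> t \<le> 3 * k / 2"
      hence n: "n = 0 \<or> n = 1" and t: "t > 0" using k by auto
      show "(diff n has_real_derivative diff (Suc n) t) (at t)"
        using n t unfolding diff_def by (auto intro!: derivative_eq_intros)
    qed
  qed (use k m False in \<open>auto simp: abs_le_iff\<close>)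
  then obtain t where t: "if k + m < k then k + m < t \<and> t < k else k < t \<and> t < k + m"
    and eq: "(k + m) powr h = (\<Sum>n<2. diff n k / fact n * (k + m - k) ^ n) + diff 2 t / fact 2 * (k + m - k) ^ 2"
    by blast
  have tk: "k / 2 \<le> t" using t m k by (auto split: if_splits simp: abs_le_iff)
  have "(k + m) powr h - k powr h - h * k powr (h - 1) * m = h * (h - 1) / 2 * t powr (h - 2) * m\<^sup>2"
    unfolding eq by (simp add: diff_def numeral_2_eq_2)
  also have "\<bar>\<dots>\<bar> = \<bar>h * (h - 1) / 2\<bar> * t powr (h - 2) * m\<^sup>2" by (simp add: abs_mult)
  also have "\<dots> \<le> 1 * (k / 2) powr (h - 2) * m\<^sup>2"
  proof (intro mult_right_mono mult_mono)
    have "\<bar>h\<bar> * \<bar>h - 1\<bar> \<le> 2 * 1" using h by (intro mult_mono) auto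
    thus "\<bar>h * (h - 1) / 2\<bar> \<le> 1" by (simp add: abs_mult)
    show "t powr (h - 2) \<le> (k / 2) powr (h - 2)" using h tk k by (intro powr_mono2') auto
  qed auto
  finally show ?thesis by simp
qed simp

text \<open>The zero sum of the filter kills both the constant and the linear Taylor term of
  \<open>\<bar>k + i - l\<bar> powr h\<close>, so only the second-order remainder survives.\<close>

lemma filter_acf_decay:
  assumes a: "is_increment_filter a" and h: "0 < h" "h < 2"
  obtains C where "C > 0" "\<And>k. k \<ge> 1 \<Longrightarrow> \<bar>filter_acf a h (real k)\<bar> \<le> C * real k powr (h - 2)"
proof -
  define L where "L = length a"
  have sum0: "(\<Sum>i<L. a ! i) = 0" using a by (simp add: is_increment_filter_def L_def)
  \<comment> \<open>\<open>C1\<close> serves lags k > 2 L, for which every shift |i - l| is at most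
    k / 2 and the Taylor bound applies. \<open>C2\<close> absorbs the finitely many smaller lags:
    the weight k powr (2 - h) makes each of them a single term of the sum.\<close>
  define C1 where "C1 = (\<Sum>i<L. \<Sum>l<L. \<bar>a ! i * a ! l\<bar> * (real L)\<^sup>2) / 2 * (1 / 2) powr (h - 2)"
  define C2 where "C2 = (\<Sum>k\<in>{1..2 * L}. \<bar>filter_acf a h (real k)\<bar> * real k powr (2 - h))"
  have C0: "C1 \<ge> 0" "C2 \<ge> 0" unfolding C1_def C2_def by (auto intro!: sum_nonneg mult_nonneg_nonneg)
  have large: "\<bar>filter_acf a h (real k)\<bar> \<le> C1 * real k powr (h - 2)" if k: "k > 2 * L" for k
  proof -
    have z: "(\<Sum>i<L. \<Sum>l<L. a ! i * a ! l * (real k powr h + h * real k powr (h - 1) * (real i - real l))) = 0"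
    proof -
      have "(\<Sum>i<L. \<Sum>l<L. a ! i * a ! l * (u + v * (real i - real l))) = 0" for u v
      proof -
        have "(\<Sum>i<L. \<Sum>l<L. a ! i * a ! l * (u + v * (real i - real l))) =
            (\<Sum>i<L. \<Sum>l<L. (a ! i * (u + v * real i)) * a ! l - a ! i * (v * real l * a ! l))"
          by (intro sum.cong refl) (simp add: algebra_simps)
        also have "\<dots> = (\<Sum>i<L. (a ! i * (u + v * real i)) * (\<Sum>l<L. a ! l)) -
            (\<Sum>i<L. a ! i * (\<Sum>l<L. v * real l * a ! l))"
          by (simp add: sum_subtractf sum_distrib_left)
        finally show ?thesis by (simp add: sum0 sum_distrib_right[symmetric])
      qed
      thus ?thesis .
    qed
    have "filter_acf a h (real k) = - 1 / 2 * (\<Sum>i<L. \<Sum>l<L. a ! i * a ! l * \<bar>real k + real i - real l\<bar> powr h)"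
      by (simp add: filter_acf_def L_def)
    also have "(\<Sum>i<L. \<Sum>l<L. a ! i * a ! l * \<bar>real k + real i - real l\<bar> powr h) =
        (\<Sum>i<L. \<Sum>l<L. a ! i * a ! l * \<bar>real k + real i - real l\<bar> powr h) -
        (\<Sum>i<L. \<Sum>l<L. a ! i * a ! l * (real k powr h + h * real k powr (h - 1) * (real i - real l)))"
      using z by simp
    also have "\<dots> = (\<Sum>i<L. \<Sum>l<L. a ! i * a ! l *
        (\<bar>real k + real i - real l\<bar> powr h - real k powr h - h * real k powr (h - 1) * (real i - real l)))"
      unfolding sum_subtractf[symmetric] by (intro sum.cong refl) (simp add: right_diff_distrib distrib_left)
    finally have eq: "filter_acf a h (real k) = - 1 / 2 * (\<Sum>i<L. \<Sum>l<L. a ! i * a ! l *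
        (\<bar>real k + real i - real l\<bar> powr h - real k powr h - h * real k powr (h - 1) * (real i - real l)))" .
    have half: "\<bar>- 1 / 2 * z\<bar> \<le> 1 / 2 * w" if "\<bar>z\<bar> \<le> w" for z w :: real
      using that by auto
    have "\<bar>filter_acf a h (real k)\<bar> \<le> 1 / 2 * (\<Sum>i<L. \<Sum>l<L. \<bar>a ! i * a ! l\<bar> *
        ((real L)\<^sup>2 * (real k / 2) powr (h - 2)))"
      unfolding eq
    proof (rule half, rule order.trans[OF sum_abs], rule sum_mono, rule order.trans[OF sum_abs], rule sum_mono)
      fix i l assume il: "i \<in> {..<L}" "l \<in> {..<L}"
      have ml: "\<bar>real i - real l\<bar> \<le> real L" using il by auto
      hence kl: "\<bar>real i - real l\<bar> \<le> real k / 2" using k by linarith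
      have pos: "\<bar>real k + real i - real l\<bar> = real k + (real i - real l)" using kl by linarith
      have "\<bar>(real k + (real i - real l)) powr h - real k powr h - h * real k powr (h - 1) * (real i - real l)\<bar>
          \<le> (real k / 2) powr (h - 2) * (real i - real l)\<^sup>2"
        using k kl by (intro powr_second_order_bound h) auto
      also have "\<dots> \<le> (real k / 2) powr (h - 2) * (real L)\<^sup>2"
        using ml power2_le_iff_abs_le[of "real L" "real i - real l"] by (intro mult_left_mono) simp_all
      finally show "\<bar>a ! i * a ! l * (\<bar>real k + real i - real l\<bar> powr h - real k powr h -
          h * real k powr (h - 1) * (real i - real l))\<bar>
        \<le> \<bar>a ! i * a ! l\<bar> * ((real L)\<^sup>2 * (real k / 2) powr (h - 2))"
        unfolding pos abs_mult[of "a ! i * a ! l"] by (intro mult_left_mono) (simp_all add: mult.commute)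
    qed
    also have "(\<Sum>i<L. \<Sum>l<L. \<bar>a ! i * a ! l\<bar> * ((real L)\<^sup>2 * (real k / 2) powr (h - 2))) =
        (\<Sum>i<L. \<Sum>l<L. \<bar>a ! i * a ! l\<bar> * (real L)\<^sup>2) * (real k / 2) powr (h - 2)"
      by (simp only: sum_distrib_right mult.assoc)
    also have "(real k / 2) powr (h - 2) = (1 / 2) powr (h - 2) * real k powr (h - 2)"
      using powr_mult[of "1 / 2" "real k" "h - 2"] by simp
    finally show ?thesis unfolding C1_def by (simp only: mult_ac times_divide_eq_left times_divide_eq_right mult_1)
  qed
  have small: "\<bar>filter_acf a h (real k)\<bar> \<le> C2 * real k powr (h - 2)" if k: "k \<ge> 1" "k \<le> 2 * L" for k
  proof -
    have "\<bar>filter_acf a h (real k)\<bar> * real k powr (2 - h) \<le> C2"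
      unfolding C2_def by (rule member_le_sum) (use k in auto)
    hence "\<bar>filter_acf a h (real k)\<bar> * real k powr (2 - h) * real k powr (h - 2) \<le> C2 * real k powr (h - 2)"
      by (rule mult_right_mono) simp
    thus ?thesis using k by (simp add: mult.assoc powr_add[symmetric])
  qed
  show ?thesis
  proof (rule that[of "C1 + C2 + 1"])
    fix k :: nat assume "k \<ge> 1"
    show "\<bar>filter_acf a h (real k)\<bar> \<le> (C1 + C2 + 1) * real k powr (h - 2)"
    proof (cases "k > 2 * L")
      case True
      show ?thesis by (rule order.trans[OF large[OF True] mult_right_mono]) (use C0 in auto)
    next
      case False
      show ?thesis by (rule order.trans[OF small mult_right_mono]) (use C0 False \<open>k \<ge> 1\<close> in auto)
    qed
  qed (use C0 in auto)
qed

text \<open>Splitting at \<open>k = sqrt n\<close> avoids the logarithm that the sharp bound has at \<open>b = 1\<close>.\<close>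

lemma sum_powr_neg_le:
  assumes b: "0 < b" "b \<le> 1"
  shows "(\<Sum>k=1..n. real k powr (- b)) \<le> 2 * real n powr (1 - b / 2)"
proof (cases "n = 0")
  case False
  define S where "S = {k. 1 \<le> k \<and> k \<le> n \<and> real k \<le> real n powr (1 / 2)}"
  have S: "S \<subseteq> {1..nat \<lfloor>real n powr (1 / 2)\<rfloor>}"
    unfolding S_def by (auto simp: le_nat_floor)
  have cS: "real (card S) \<le> real n powr (1 / 2)"
  proof -
    have "card S \<le> nat \<lfloor>real n powr (1 / 2)\<rfloor>" using card_mono[OF _ S] by simp
    also have "real (nat \<lfloor>real n powr (1 / 2)\<rfloor>) \<le> real n powr (1 / 2)" by simp
    finally show ?thesis by simp
  qed
  have "(\<Sum>k=1..n. real k powr (- b)) \<le> (\<Sum>k=1..n. (if k \<in> S then 1 else 0) + real n powr (- b / 2))"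
  proof (rule sum_mono)
    fix k assume k: "k \<in> {1..n}"
    show "real k powr (- b) \<le> (if k \<in> S then 1 else 0) + real n powr (- b / 2)"
    proof (cases "k \<in> S")
      case True
      have "real k powr (- b) \<le> real k powr 0" using k b by (intro powr_mono) auto
      thus ?thesis using True k by (simp add: add_increasing2)
    next
      case False
      hence "real n powr (1 / 2) \<le> real k" using k by (auto simp: S_def)
      hence "real k powr (- b) \<le> (real n powr (1 / 2)) powr (- b)"
        using b \<open>n \<noteq> 0\<close> by (intro powr_mono2') auto
      thus ?thesis using False by (simp add: powr_powr)
    qed
  qed
  also have "\<dots> = real (card S) + real n * real n powr (- b / 2)"
    by (simp add: sum.distrib sum.If_cases S_def Int_def)
  also have "real n * real n powr (- b / 2) = real n powr (1 - b / 2)"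
    using powr_add[of "real n" 1 "- b / 2"] by simp
  \<comment> \<open>Here b \<le> 1 enters, as 1/2 \<le> 1 - b/2.\<close>
  also have "real (card S) \<le> real n powr (1 - b / 2)"
    using cS b False by (elim order.trans) (intro powr_mono, auto)
  finally show ?thesis by simp
qed simp

lemma filter_acf_row_sum:
  assumes a: "is_increment_filter a" and h: "0 < h" "h < 2"
  obtains C b where "C > 0" "b > 0"
    "\<And>n N i. n \<ge> 1 \<Longrightarrow> N \<le> n \<Longrightarrow> i < N \<Longrightarrow>
       (\<Sum>j<N. \<bar>filter_acf a h (real i - real j)\<bar>) \<le> C * real n powr (1 - b)"
proof -
  obtain C where C: "C > 0" "\<And>k. k \<ge> 1 \<Longrightarrow> \<bar>filter_acf a h (real k)\<bar> \<le> C * real k powr (h - 2)"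
    by (rule filter_acf_decay[OF a h]) blast
  \<comment> \<open>The cap at 1 meets the requirement of \<open>sum_powr_neg_le\<close>; for h < 1
    the actual decay is faster, but the weaker rate suffices. The splitting in that lemma halves the
    exponent, so \<open>b / 2\<close> is returned. Each lag occurs at most twice in a row, whence
    the factor 2.\<close>
  define b where "b = min (2 - h) 1"
  have b: "0 < b" "b \<le> 1" "h - 2 \<le> - b" using h by (auto simp: b_def)
  define g where "g = (\<lambda>k. \<bar>filter_acf a h (real k)\<bar>)"
  have gs: "(\<Sum>k\<le>n. g k) \<le> (g 0 + 2 * C) * real n powr (1 - b / 2)" if n: "n \<ge> 1" for n
  proof -
    have "(\<Sum>k\<le>n. g k) = g 0 + (\<Sum>k=1..n. g k)"
      by (simp add: atMost_atLeast0 sum.atLeast_Suc_atMost)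
    also have "(\<Sum>k=1..n. g k) \<le> (\<Sum>k=1..n. C * real k powr (- b))"
    proof (rule sum_mono)
      fix k assume k: "k \<in> {1..n}"
      have "g k \<le> C * real k powr (h - 2)" using C(2)[of k] k by (simp add: g_def)
      also have "\<dots> \<le> C * real k powr (- b)"
        using C(1) b k by (intro mult_left_mono powr_mono) auto
      finally show "g k \<le> C * real k powr (- b)" .
    qed
    also have "\<dots> \<le> C * (2 * real n powr (1 - b / 2))"
      unfolding sum_distrib_left[symmetric] using C(1) by (intro mult_left_mono sum_powr_neg_le b) auto
    also have "g 0 \<le> g 0 * real n powr (1 - b / 2)"
      using n b by (intro mult_le_cancel_left1[THEN iffD2]) (auto simp: g_def ge_one_powr_ge_zero)
    finally show ?thesis by (simp add: algebra_simps)
  qed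
  show ?thesis
  proof (rule that[of "2 * (g 0 + 2 * C)" "b / 2"])
    show "2 * (g 0 + 2 * C) > 0" using C(1) by (simp add: g_def add_nonneg_pos)
    show "b / 2 > 0" using b by simp
    fix n N i :: nat assume n: "n \<ge> 1" and N: "N \<le> n" "i < N"
    have g': "\<bar>filter_acf a h (real i - real j)\<bar> = g (if j \<le> i then i - j else j - i)" for j
      using filter_acf_minus[of a h "real (j - i)"] by (auto simp: g_def of_nat_diff)
    have g0: "g k \<ge> 0" for k by (simp add: g_def)
    have "(\<Sum>j<N. \<bar>filter_acf a h (real i - real j)\<bar>) =
        (\<Sum>j\<in>{..i}. g (i - j)) + (\<Sum>j\<in>{i<..<N}. g (j - i))"
    proof -
      let ?F = "\<lambda>j. g (if j \<le> i then i - j else j - i)"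
      have u: "{..i} \<union> {i<..<N} = {..<N}" using N by auto
      have "sum ?F ({..i} \<union> {i<..<N}) = sum ?F {..i} + sum ?F {i<..<N}"
        by (rule sum.union_disjoint) auto
      moreover have "sum ?F {..i} = (\<Sum>j\<in>{..i}. g (i - j))" by (rule sum.cong) auto
      moreover have "sum ?F {i<..<N} = (\<Sum>j\<in>{i<..<N}. g (j - i))" by (rule sum.cong) auto
      ultimately show ?thesis unfolding g' u by (simp only:)
    qed
    also have "(\<Sum>j\<in>{..i}. g (i - j)) = (\<Sum>k\<le>i. g k)"
      by (rule sum.reindex_bij_witness[of _ "\<lambda>k. i - k" "\<lambda>k. i - k"]) auto
    also have "\<dots> \<le> (\<Sum>k\<le>n. g k)" using N g0 by (intro sum_mono2) auto
    also have "(\<Sum>j\<in>{i<..<N}. g (j - i)) = (\<Sum>k\<in>{0<..<N - i}. g k)"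
      by (rule sum.reindex_bij_witness[of _ "\<lambda>k. k + i" "\<lambda>k. k - i"]) auto
    also have "\<dots> \<le> (\<Sum>k\<le>n. g k)" using N g0 by (intro sum_mono2) auto
    finally have "(\<Sum>j<N. \<bar>filter_acf a h (real i - real j)\<bar>) \<le> 2 * (\<Sum>k\<le>n. g k)" by simp
    also have "\<dots> \<le> 2 * ((g 0 + 2 * C) * real n powr (1 - b / 2))"
      by (intro mult_left_mono gs n) simp
    finally show "(\<Sum>j<N. \<bar>filter_acf a h (real i - real j)\<bar>) \<le>
        2 * (g 0 + 2 * C) * real n powr (1 - b / 2)"
      by (simp only: mult.assoc)
  qed
qed

section \<open>Filtered increments of fractional Brownian motion\<close>

lemma increment_filter_length: "is_increment_filter a \<Longrightarrow> length a = Suc (filter_order a)"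
  by (auto simp: is_increment_filter_def filter_order_def)

context prob_space
begin

text \<open>\<open>gaussian_process\<close> speaks of sums over sets of distinct times, while
  overlapping filter windows evaluate the process repeatedly at the same time. Coefficients are
  therefore collected time by time.\<close>

lemma gaussian_process_linear_combination:
  assumes B: "gaussian_process M T B" and I: "finite I" "\<And>i. i \<in> I \<Longrightarrow> t i \<in> T"
  shows "gaussian_rv M (\<lambda>\<omega>. \<Sum>i\<in>I. c i * B (t i) \<omega>)"
proof -
  have "(\<Sum>i\<in>I. c i * B (t i) \<omega>) = (\<Sum>s\<in>t ` I. (\<Sum>i\<in>{i \<in> I. t i = s}. c i) * B s \<omega>)" for \<omega>
    unfolding sum.image_gen[OF I(1), of "\<lambda>i. c i * B (t i) \<omega>" t]
    by (intro sum.cong refl) (simp add: sum_distrib_right)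
  moreover have "gaussian_rv M (\<lambda>\<omega>. \<Sum>s\<in>t ` I. (\<Sum>i\<in>{i \<in> I. t i = s}. c i) * B s \<omega>)"
    by (rule B[unfolded gaussian_process_def, rule_format]) (use I in auto)
  ultimately show ?thesis by simp
qed

context
  fixes T H B
  assumes fbm: "fractional_brownian_motion M T H B"
begin

lemma fbm_gaussian:
  assumes "t \<in> T" shows "gaussian_rv M (B t)" "expectation (B t) = 0"
proof -
  have "gaussian_process M T B" using fbm by (simp add: fractional_brownian_motion_def)
  from gaussian_process_linear_combination[OF this, of "{()}" "\<lambda>_. t" "\<lambda>_. 1"] assms
  show "gaussian_rv M (B t)" by simp
  show "expectation (B t) = 0" using fbm assms by (simp add: fractional_brownian_motion_def)
qed

lemma fbm_measurable: "t \<in> T \<Longrightarrow> B t \<in> borel_measurable M"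
  using fbm_gaussian(1) by (simp add: gaussian_rv_def)

lemma fbm_square_integrable: "t \<in> T \<Longrightarrow> integrable M (\<lambda>\<omega>. (B t \<omega>)\<^sup>2)"
  using centered_gaussian_square_integrable fbm_gaussian by blast

lemma fbm_integrable: "t \<in> T \<Longrightarrow> integrable M (B t)"
  using square_integrable_imp_integrable fbm_measurable fbm_square_integrable by blast

lemma fbm_integrable_mult:
  "s \<in> T \<Longrightarrow> t \<in> T \<Longrightarrow> integrable M (\<lambda>\<omega>. B s \<omega> * B t \<omega>)"
  by (intro integrable_mult_of_squares fbm_measurable fbm_square_integrable)

lemma fbm_linear_images_gaussian_vector:
  fixes L :: nat
  assumes "\<And>i j. i < L \<Longrightarrow> j < N \<Longrightarrow> t i j \<in> T"
  shows "centered_gaussian_vector M N (\<lambda>j \<omega>. c * (\<Sum>i<L. b i * B (t i j) \<omega>))"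
  unfolding centered_gaussian_vector_def
proof (intro allI)
  fix g :: "nat \<Rightarrow> real"
  have eq: "(\<Sum>j<N. g j * (c * (\<Sum>i<L. b i * B (t i j) \<omega>))) =
      (\<Sum>p\<in>{..<N} \<times> {..<L}. (g (fst p) * c * b (snd p)) * B (t (snd p) (fst p)) \<omega>)" for \<omega>
    by (simp add: sum_distrib_left sum.cartesian_product case_prod_beta mult_ac)
  have "gaussian_process M T B" using fbm by (simp add: fractional_brownian_motion_def)
  hence "gaussian_rv M (\<lambda>\<omega>. \<Sum>p\<in>{..<N} \<times> {..<L}. (g (fst p) * c * b (snd p)) * B (t (snd p) (fst p)) \<omega>)"
    by (rule gaussian_process_linear_combination) (auto intro: assms)
  moreover have "expectation (\<lambda>\<omega>. \<Sum>p\<in>{..<N} \<times> {..<L}. (g (fst p) * c * b (snd p)) * B (t (snd p) (fst p)) \<omega>) =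
      (\<Sum>p\<in>{..<N} \<times> {..<L}. expectation (\<lambda>\<omega>. (g (fst p) * c * b (snd p)) * B (t (snd p) (fst p)) \<omega>))"
    by (rule Bochner_Integration.integral_sum) (auto intro!: fbm_integrable assms)
  moreover have "\<dots> = 0"
    by (rule sum.neutral) (auto simp: fbm_gaussian(2) assms)
  ultimately show "gaussian_rv M (\<lambda>\<omega>. \<Sum>j<N. g j * (c * (\<Sum>i<L. b i * B (t i j) \<omega>))) \<and>
      expectation (\<lambda>\<omega>. \<Sum>j<N. g j * (c * (\<Sum>i<L. b i * B (t i j) \<omega>))) = 0"
    unfolding eq by simp
qed

text \<open>The parts t^(2H) and s^(2H) of the covariance each depend on one summation index only,
  so the zero sum over the other index removes them. What survives depends on the time difference
  alone and is homogeneous of degree 2H in \<Delta>.\<close>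

lemma fbm_filtered_covariance:
  assumes a: "(\<Sum>q<length a. a ! q) = 0" and D: "\<Delta> > 0"
    and j: "\<And>i. i < length a \<Longrightarrow> real (i + j) * \<Delta> \<in> T"
    and k: "\<And>i. i < length a \<Longrightarrow> real (i + k) * \<Delta> \<in> T"
  shows "expectation (\<lambda>\<omega>. (\<Sum>i<length a. a ! i * B (real (i + j) * \<Delta>) \<omega>) *
      (\<Sum>l<length a. a ! l * B (real (l + k) * \<Delta>) \<omega>)) =
    \<Delta> powr (2 * H) * filter_acf a (2 * H) (real j - real k)"
proof -
  define L where "L = length a"
  define u where "u = (\<lambda>i j. (real (i + j) * \<Delta>) powr (2 * H))"
  have cov: "expectation (\<lambda>\<omega>. B s \<omega> * B t \<omega>) =
      1 / 2 * (s powr (2 * H) + t powr (2 * H) - \<bar>s - t\<bar> powr (2 * H))" if "s \<in> T" "t \<in> T" for s t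
    using fbm that by (simp add: fractional_brownian_motion_def)
  have sum0: "(\<Sum>q<L. a ! q) = 0" using a by (simp add: L_def)
  have scale: "\<bar>real (i + j) * \<Delta> - real (l + k) * \<Delta>\<bar> powr (2 * H) =
      \<Delta> powr (2 * H) * \<bar>(real j - real k) + real i - real l\<bar> powr (2 * H)" for i l
  proof -
    have "real (i + j) * \<Delta> - real (l + k) * \<Delta> = ((real j - real k) + real i - real l) * \<Delta>"
      by (simp add: algebra_simps)
    hence "\<bar>real (i + j) * \<Delta> - real (l + k) * \<Delta>\<bar> = \<Delta> * \<bar>(real j - real k) + real i - real l\<bar>"
      using D by (simp add: abs_mult)
    thus ?thesis using D by (simp add: powr_mult)
  qed
  have "expectation (\<lambda>\<omega>. (\<Sum>i<L. a ! i * B (real (i + j) * \<Delta>) \<omega>) *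
        (\<Sum>l<L. a ! l * B (real (l + k) * \<Delta>) \<omega>)) =
      expectation (\<lambda>\<omega>. \<Sum>i<L. \<Sum>l<L. (a ! i * a ! l) * (B (real (i + j) * \<Delta>) \<omega> * B (real (l + k) * \<Delta>) \<omega>))"
    by (simp add: sum_product mult_ac)
  also have "\<dots> = (\<Sum>i<L. expectation (\<lambda>\<omega>. \<Sum>l<L. (a ! i * a ! l) * (B (real (i + j) * \<Delta>) \<omega> * B (real (l + k) * \<Delta>) \<omega>)))"
    by (rule Bochner_Integration.integral_sum)
      (auto intro!: Bochner_Integration.integrable_sum integrable_mult_right fbm_integrable_mult
        j k simp: L_def simp del: of_nat_add)
  also have "\<dots> = (\<Sum>i<L. \<Sum>l<L. expectation (\<lambda>\<omega>. (a ! i * a ! l) * (B (real (i + j) * \<Delta>) \<omega> * B (real (l + k) * \<Delta>) \<omega>)))"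
    by (intro sum.cong refl Bochner_Integration.integral_sum)
      (auto intro!: integrable_mult_right fbm_integrable_mult j k simp: L_def simp del: of_nat_add)
  also have "\<dots> = (\<Sum>i<L. \<Sum>l<L. (a ! i * a ! l) * (1 / 2 * (u i j + u l k -
      \<Delta> powr (2 * H) * \<bar>(real j - real k) + real i - real l\<bar> powr (2 * H))))"
  proof (intro sum.cong refl)
    fix i l assume il: "i \<in> {..<L}" "l \<in> {..<L}"
    have "expectation (\<lambda>\<omega>. (a ! i * a ! l) * (B (real (i + j) * \<Delta>) \<omega> * B (real (l + k) * \<Delta>) \<omega>)) =
        (a ! i * a ! l) * expectation (\<lambda>\<omega>. B (real (i + j) * \<Delta>) \<omega> * B (real (l + k) * \<Delta>) \<omega>)"
      by (rule integral_mult_right_zero)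
    also have "expectation (\<lambda>\<omega>. B (real (i + j) * \<Delta>) \<omega> * B (real (l + k) * \<Delta>) \<omega>) =
        1 / 2 * (u i j + u l k - \<Delta> powr (2 * H) * \<bar>(real j - real k) + real i - real l\<bar> powr (2 * H))"
      unfolding u_def scale[symmetric] by (rule cov) (use il j k in \<open>auto simp: L_def\<close>)
    finally show "expectation (\<lambda>\<omega>. (a ! i * a ! l) * (B (real (i + j) * \<Delta>) \<omega> * B (real (l + k) * \<Delta>) \<omega>)) =
        (a ! i * a ! l) * (1 / 2 * (u i j + u l k -
          \<Delta> powr (2 * H) * \<bar>(real j - real k) + real i - real l\<bar> powr (2 * H)))" .
  qed
  also have "\<dots> = (\<Sum>i<L. \<Sum>l<L. (a ! i * u i j / 2) * a ! l) + (\<Sum>i<L. \<Sum>l<L. a ! i * (a ! l * u l k / 2)) +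
      (\<Sum>i<L. \<Sum>l<L. \<Delta> powr (2 * H) * (- 1 / 2) * (a ! i * a ! l * \<bar>(real j - real k) + real i - real l\<bar> powr (2 * H)))"
    unfolding sum.distrib[symmetric] by (intro sum.cong refl) (simp add: field_simps)
  also have "(\<Sum>i<L. \<Sum>l<L. (a ! i * u i j / 2) * a ! l) = 0"
    unfolding sum_distrib_left[symmetric] sum0 by simp
  also have "(\<Sum>i<L. \<Sum>l<L. a ! i * (a ! l * u l k / 2)) = 0"
    unfolding sum_product[symmetric] sum0 by simp
  finally show ?thesis unfolding sum_distrib_left[symmetric] filter_acf_def L_def by simp
qed

text \<open>Scaling by \<Delta>^(-H) gives all rows the same covariance function
  \<open>filter_acf a (2 * H)\<close>, so one pair \<open>C\<close>, \<open>b\<close> bounds the row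
  sums uniformly in n.\<close>

lemma fbm_quadratic_variation_limit:
  assumes a: "is_increment_filter a"
    and T: "\<And>n k. n \<ge> 1 \<Longrightarrow> k \<le> n \<Longrightarrow> real k * real n powr (- \<alpha>) \<in> T"
  shows "AE \<omega> in M. (\<lambda>n. (real n powr (- \<alpha>)) powr (- 2 * H) *
      filtered_quadratic_variation a n (real n powr (- \<alpha>)) (\<lambda>t. B t \<omega>)) \<longlonglongrightarrow> filter_acf a (2 * H) 0"
proof -
  define L where "L = length a"
  define p where "p = filter_order a"
  define \<Delta> where "\<Delta> = (\<lambda>n. real n powr (- \<alpha>))"
  define N where "N = (\<lambda>n. n - p)"
  have L: "L = Suc p" using increment_filter_length[OF a] by (simp add: L_def p_def)
  have H: "0 < H" "H < 1" using fbm by (auto simp: fractional_brownian_motion_def)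
  have sum0: "(\<Sum>q<length a. a ! q) = 0" using a by (simp add: is_increment_filter_def)
  \<comment> \<open>Array columns start at 0 but increments at 1, hence \<open>Suc j\<close>. The
    last time index used is then p + (n - p) = n, within the range covered by the assumption on
    T.\<close>
  define Y where "Y = (\<lambda>n j \<omega>. \<Delta> n powr (- H) * (\<Sum>i<L. a ! i * B (real (i + Suc j) * \<Delta> n) \<omega>))"
  have times: "real (i + Suc j) * \<Delta> n \<in> T" if "n \<ge> 1" "i < L" "j < N n" for n i j
    unfolding \<Delta>_def by (rule T) (use that L in \<open>auto simp: N_def\<close>)
  have D0: "\<Delta> n > 0" if "n \<ge> 1" for n using that by (simp add: \<Delta>_def)
  have cov: "expectation (\<lambda>\<omega>. Y n i \<omega> * Y n j \<omega>) = filter_acf a (2 * H) (real i - real j)"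
    if n: "n \<ge> 1" "i < N n" "j < N n" for n i j
  proof -
    have "expectation (\<lambda>\<omega>. Y n i \<omega> * Y n j \<omega>) = expectation (\<lambda>\<omega>. (\<Delta> n powr (- H) * \<Delta> n powr (- H)) *
        ((\<Sum>q<length a. a ! q * B (real (q + Suc i) * \<Delta> n) \<omega>) *
         (\<Sum>l<length a. a ! l * B (real (l + Suc j) * \<Delta> n) \<omega>)))"
      by (simp add: Y_def L_def mult_ac)
    also have "\<dots> = (\<Delta> n powr (- H) * \<Delta> n powr (- H)) *
        expectation (\<lambda>\<omega>. (\<Sum>q<length a. a ! q * B (real (q + Suc i) * \<Delta> n) \<omega>) *
         (\<Sum>l<length a. a ! l * B (real (l + Suc j) * \<Delta> n) \<omega>))"
      by (rule integral_mult_right_zero)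
    also have "expectation (\<lambda>\<omega>. (\<Sum>q<length a. a ! q * B (real (q + Suc i) * \<Delta> n) \<omega>) *
         (\<Sum>l<length a. a ! l * B (real (l + Suc j) * \<Delta> n) \<omega>)) =
        \<Delta> n powr (2 * H) * filter_acf a (2 * H) (real (Suc i) - real (Suc j))"
      by (rule fbm_filtered_covariance[OF sum0 D0[OF n(1)]]) (use times n in \<open>auto simp: L_def\<close>)
    also have "(\<Delta> n powr (- H) * \<Delta> n powr (- H)) * (\<Delta> n powr (2 * H) * filter_acf a (2 * H) (real (Suc i) - real (Suc j))) =
        (\<Delta> n powr (- H) * \<Delta> n powr (- H) * \<Delta> n powr (2 * H)) * filter_acf a (2 * H) (real i - real j)"
      by simp
    also have "\<Delta> n powr (- H) * \<Delta> n powr (- H) * \<Delta> n powr (2 * H) = 1"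
      unfolding powr_add[symmetric] using D0[OF n(1)] by simp
    finally show ?thesis by simp
  qed
  obtain C b where Cb: "C > 0" "b > 0"
    "\<And>n N i. n \<ge> 1 \<Longrightarrow> N \<le> n \<Longrightarrow> i < N \<Longrightarrow>
       (\<Sum>j<N. \<bar>filter_acf a (2 * H) (real i - real j)\<bar>) \<le> C * real n powr (1 - b)"
    by (rule filter_acf_row_sum[OF a, of "2 * H"]) (use H in auto)
  have "AE \<omega> in M. (\<lambda>n. (\<Sum>j<N n. (Y n j \<omega>)\<^sup>2) / real n - real (N n) * filter_acf a (2 * H) 0 / real n) \<longlonglongrightarrow> 0"
  proof (rule gaussian_array_strong_law[OF _ Cb(1,2)])
    show "N n \<le> n" for n by (simp add: N_def)
    show "centered_gaussian_vector M (N n) (Y n)" if "n \<ge> 1" for n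
      unfolding Y_def by (rule fbm_linear_images_gaussian_vector) (rule times[OF that])
    show "expectation (\<lambda>\<omega>. (Y n j \<omega>)\<^sup>2) = filter_acf a (2 * H) 0" if "n \<ge> 1" "j < N n" for n j
      using cov[OF that that(2)] by (simp add: power2_eq_square)
    show "(\<Sum>j<N n. \<bar>expectation (\<lambda>\<omega>. Y n i \<omega> * Y n j \<omega>)\<bar>) \<le> C * real n powr (1 - b)"
      if "n \<ge> 1" "i < N n" for n i
      using Cb(3)[OF that(1) _ that(2)] cov[OF that] by (simp add: N_def)
  qed
  thus ?thesis
  proof (rule AE_mp, intro AE_I2 impI)
    fix \<omega>
    assume lim: "(\<lambda>n. (\<Sum>j<N n. (Y n j \<omega>)\<^sup>2) / real n - real (N n) * filter_acf a (2 * H) 0 / real n) \<longlonglongrightarrow> 0"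
    have "(\<lambda>n. real (n - p) / real n) \<longlonglongrightarrow> 1"
    proof (rule Lim_transform_eventually)
      show "(\<lambda>n. (real n - real p) / real n) \<longlonglongrightarrow> 1" by real_asymp
      show "eventually (\<lambda>n. (real n - real p) / real n = real (n - p) / real n) at_top"
        using eventually_ge_at_top[of p] by eventually_elim simp
    qed
    hence "(\<lambda>n. real (N n) * filter_acf a (2 * H) 0 / real n) \<longlonglongrightarrow> filter_acf a (2 * H) 0"
      using tendsto_mult_right[of "\<lambda>n. real (n - p) / real n" 1 _ "filter_acf a (2 * H) 0"]
      by (simp add: N_def)
    from tendsto_add[OF lim this]
    have "(\<lambda>n. (\<Sum>j<N n. (Y n j \<omega>)\<^sup>2) / real n) \<longlonglongrightarrow> filter_acf a (2 * H) 0" by simp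
    moreover have "(\<Sum>j<N n. (Y n j \<omega>)\<^sup>2) / real n =
        \<Delta> n powr (- 2 * H) * filtered_quadratic_variation a n (\<Delta> n) (\<lambda>t. B t \<omega>)" for n
    proof -
      have "(Y n j \<omega>)\<^sup>2 = \<Delta> n powr (- 2 * H) * (filtered_increment a (\<Delta> n) (\<lambda>t. B t \<omega>) (Suc j))\<^sup>2" for j
      proof -
        have "{0..p} = {..<L}" using L by auto
        hence "filtered_increment a (\<Delta> n) (\<lambda>t. B t \<omega>) (Suc j) =
            (\<Sum>i<L. a ! i * B (real (i + Suc j) * \<Delta> n) \<omega>)"
          by (simp add: filtered_increment_def p_def[symmetric])
        moreover have "(\<Delta> n powr (- H))\<^sup>2 = \<Delta> n powr (- 2 * H)"
          unfolding power2_eq_square powr_add[symmetric] by simp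
        ultimately show ?thesis by (simp add: Y_def power_mult_distrib)
      qed
      thus ?thesis
        by (simp add: filtered_quadratic_variation_def N_def p_def[symmetric] sum.atLeast1_atMost_eq
            sum_distrib_left[symmetric])
    qed
    ultimately show "(\<lambda>n. (real n powr (- \<alpha>)) powr (- 2 * H) *
      filtered_quadratic_variation a n (real n powr (- \<alpha>)) (\<lambda>t. B t \<omega>)) \<longlonglongrightarrow> filter_acf a (2 * H) 0"
      by (simp only: \<Delta>_def)
  qed
qed

end
end

text \<open>The zero sum of the filter removes \<open>x\<close> and allows D to be measured from the
  left end of the window, so each rescaled increment moves by at most e, of order d * d powr (- H).
  Expanding the square and using 2 |y| \<le> y^2 + 1 leaves only the quadratic variation of
  \<open>b\<close> itself in the bound, with no cross term.\<close>

lemma filtered_quadratic_variation_perturbation: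
  fixes H d K :: real
  assumes a: "is_increment_filter a" and K: "K \<ge> 0"
    and z: "\<And>t. t \<in> T \<Longrightarrow> z t = x + D t + b t"
    and lip: "\<And>s t. s \<in> T \<Longrightarrow> t \<in> T \<Longrightarrow> \<bar>D t - D s\<bar> \<le> K * \<bar>t - s\<bar>"
    and d: "d > 0" and T: "\<And>k. k \<le> n \<Longrightarrow> real k * d \<in> T"
  defines "e \<equiv> (\<Sum>i<length a. \<bar>a ! i\<bar>) * K * real (filter_order a) * d powr (1 - H)"
  shows "\<bar>d powr (- 2 * H) * filtered_quadratic_variation a n d z -
      d powr (- 2 * H) * filtered_quadratic_variation a n d b\<bar> \<le>
    e * (d powr (- 2 * H) * filtered_quadratic_variation a n d b) + e + e\<^sup>2"
proof (cases "n = 0")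
  case True
  thus ?thesis using K d by (simp add: filtered_quadratic_variation_def e_def sum_nonneg)
next
  case False
  define p where "p = filter_order a"
  define L where "L = length a"
  have L: "L = Suc p" using increment_filter_length[OF a] by (simp add: L_def p_def)
  have Lp: "{0..p} = {..<L}" using L by auto
  have sum0: "(\<Sum>q<L. a ! q) = 0" using a by (simp add: is_increment_filter_def L_def)
  have e0: "e \<ge> 0" using K d by (simp add: e_def sum_nonneg)
  define y where "y = (\<lambda>j. d powr (- H) * filtered_increment a d b j)"
  define w where "w = (\<lambda>j. d powr (- H) * filtered_increment a d z j)"
  have sq: "(d powr (- H))\<^sup>2 = d powr (- 2 * H)"
    unfolding power2_eq_square powr_add[symmetric] by simp
  have V: "d powr (- 2 * H) * filtered_quadratic_variation a n d b = (\<Sum>j=1..n - p. (y j)\<^sup>2) / real n"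
    "d powr (- 2 * H) * filtered_quadratic_variation a n d z = (\<Sum>j=1..n - p. (w j)\<^sup>2) / real n"
    unfolding filtered_quadratic_variation_def y_def w_def p_def power_mult_distrib sq
      sum_distrib_left[symmetric] by simp_all
  have bound: "\<bar>(w j)\<^sup>2 - (y j)\<^sup>2\<bar> \<le> e * (y j)\<^sup>2 + e + e\<^sup>2" if j: "j \<in> {1..n - p}" for j
  proof -
    have tT: "real (i + j) * d \<in> T" if "i < L" for i
      by (rule T) (use that j L in auto)
    have "filtered_increment a d z j = (\<Sum>i<L. a ! i * (x + D (real (i + j) * d) + b (real (i + j) * d)))"
      unfolding filtered_increment_def p_def[symmetric] Lp
      by (intro sum.cong refl) (use z tT in auto)
    also have "\<dots> = (\<Sum>i<L. a ! i) * (x + D (real (0 + j) * d)) +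
        (\<Sum>i<L. a ! i * (D (real (i + j) * d) - D (real (0 + j) * d))) + filtered_increment a d b j"
      unfolding filtered_increment_def p_def[symmetric] Lp sum_distrib_right sum.distrib[symmetric]
      by (intro sum.cong refl) (simp add: algebra_simps)
    finally have diff: "w j - y j = d powr (- H) * (\<Sum>i<L. a ! i * (D (real (i + j) * d) - D (real (0 + j) * d)))"
      unfolding w_def y_def sum0 by (simp add: algebra_simps)
    have "\<bar>\<Sum>i<L. a ! i * (D (real (i + j) * d) - D (real (0 + j) * d))\<bar> \<le>
        (\<Sum>i<L. \<bar>a ! i\<bar> * (K * (real p * d)))"
    proof (rule order.trans[OF sum_abs], rule sum_mono)
      fix i assume i: "i \<in> {..<L}"
      have "\<bar>D (real (i + j) * d) - D (real (0 + j) * d)\<bar> \<le> K * \<bar>real (i + j) * d - real (0 + j) * d\<bar>"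
        by (intro lip tT) (use i L in auto)
      also have "\<bar>real (i + j) * d - real (0 + j) * d\<bar> = real i * d"
        using d by (simp add: algebra_simps)
      also have "K * (real i * d) \<le> K * (real p * d)"
        using i L K d by (intro mult_left_mono mult_right_mono) auto
      finally show "\<bar>a ! i * (D (real (i + j) * d) - D (real (0 + j) * d))\<bar> \<le> \<bar>a ! i\<bar> * (K * (real p * d))"
        unfolding abs_mult by (intro mult_left_mono) auto
    qed
    hence "\<bar>w j - y j\<bar> \<le> d powr (- H) * (\<Sum>i<L. \<bar>a ! i\<bar> * (K * (real p * d)))"
      unfolding diff abs_mult by (simp add: mult_left_mono)
    also have "\<dots> = (\<Sum>i<L. \<bar>a ! i\<bar>) * K * real p * (d powr (- H) * d powr 1)"
      using d by (simp add: sum_distrib_right[symmetric])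
    also have "\<dots> = e" unfolding powr_add[symmetric] by (simp add: e_def p_def L_def)
    finally have we: "\<bar>w j - y j\<bar> \<le> e" .
    have "(w j)\<^sup>2 - (y j)\<^sup>2 = 2 * (y j * (w j - y j)) + (w j - y j)\<^sup>2"
      by (simp add: power2_eq_square algebra_simps)
    hence "\<bar>(w j)\<^sup>2 - (y j)\<^sup>2\<bar> \<le> 2 * (\<bar>y j\<bar> * \<bar>w j - y j\<bar>) + \<bar>w j - y j\<bar>\<^sup>2"
      using abs_triangle_ineq[of "2 * (y j * (w j - y j))" "(w j - y j)\<^sup>2"] by (simp add: abs_mult)
    also have "\<dots> \<le> 2 * (\<bar>y j\<bar> * e) + e\<^sup>2"
      using we by (intro add_mono mult_left_mono power_mono) auto
    also have "2 * (\<bar>y j\<bar> * e) \<le> e * ((y j)\<^sup>2 + 1)"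
    proof -
      have "2 * \<bar>y j\<bar> \<le> (y j)\<^sup>2 + 1" using sum_squares_bound[of "\<bar>y j\<bar>" 1] by simp
      from mult_left_mono[OF this e0] show ?thesis by (simp add: mult_ac)
    qed
    finally show ?thesis by (simp add: algebra_simps)
  qed
  have "\<bar>(\<Sum>j=1..n - p. (w j)\<^sup>2) / real n - (\<Sum>j=1..n - p. (y j)\<^sup>2) / real n\<bar> =
      \<bar>\<Sum>j=1..n - p. (w j)\<^sup>2 - (y j)\<^sup>2\<bar> / real n"
    by (simp add: sum_subtractf diff_divide_distrib[symmetric])
  also have "\<dots> \<le> (\<Sum>j=1..n - p. e * (y j)\<^sup>2 + (e + e\<^sup>2)) / real n"
    using bound by (intro divide_right_mono order.trans[OF sum_abs] sum_mono) (auto simp: add_ac)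
  also have "\<dots> = e * ((\<Sum>j=1..n - p. (y j)\<^sup>2) / real n) + real (n - p) / real n * (e + e\<^sup>2)"
    by (simp add: sum.distrib sum_distrib_left[symmetric] add_divide_distrib)
  also have "real (n - p) / real n * (e + e\<^sup>2) \<le> 1 * (e + e\<^sup>2)"
    using e0 False by (intro mult_right_mono) auto
  finally show ?thesis unfolding V by simp
qed

section \<open>Consistency of the estimators\<close>

text \<open>Index pairs are grouped by their distance d through (d, k) \<mapsto> (k, k + d). The two
  triangles contribute equally, which cancels the factor 1/2, and the diagonal vanishes; the
  coefficient of d^h is then an entry of the filter matrix.\<close>

lemma filter_acf_zero_eq:
  assumes a: "is_increment_filter a" and h: "h > 0"
  shows "filter_acf a h 0 =
    (\<Sum>d=1..filter_order a. - (\<Sum>k=0..filter_order a - d. a ! k * a ! (k + d)) * real d powr h)"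
proof -
  define p where "p = filter_order a"
  define L where "L = length a"
  have L: "L = Suc p" using increment_filter_length[OF a] by (simp add: L_def p_def)
  define F where "F = (\<lambda>(i, l). a ! i * a ! l * \<bar>real i - real l\<bar> powr h)"
  define U where "U = {(i, l). i < l \<and> l < L}"
  define V where "V = {(i, l). l < i \<and> i < L}"
  define E where "E = {(i, l). i = l \<and> i < L}"
  have sub: "U \<subseteq> {..<L} \<times> {..<L}" "V \<subseteq> {..<L} \<times> {..<L}" "E \<subseteq> {..<L} \<times> {..<L}"
    by (auto simp: U_def V_def E_def)
  have fin: "finite U" "finite V" "finite E" using sub by (auto intro: finite_subset)
  have "{..<L} \<times> {..<L} = U \<union> V \<union> E" by (auto simp: U_def V_def E_def)
  hence "(\<Sum>i<L. \<Sum>l<L. F (i, l)) = sum F (U \<union> V \<union> E)"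
    by (simp add: sum.cartesian_product)
  also have "\<dots> = sum F U + sum F V + sum F E"
    using fin by (subst sum.union_disjoint, simp_all, force simp: U_def V_def E_def)
      (subst sum.union_disjoint, auto simp: U_def V_def)
  also have "sum F E = 0" using h by (intro sum.neutral) (auto simp: E_def F_def)
  also have "sum F V = sum F U"
    by (rule sum.reindex_bij_witness[of _ "\<lambda>(i, l). (l, i)" "\<lambda>(i, l). (l, i)"])
      (auto simp: U_def V_def F_def abs_minus_commute)
  also have "sum F U = (\<Sum>(d, k)\<in>(SIGMA d:{1..p}. {0..p - d}). a ! k * a ! (k + d) * real d powr h)"
    by (rule sum.reindex_bij_witness[of _ "\<lambda>(d, k). (k, k + d)" "\<lambda>(i, l). (l - i, i)"])
      (auto simp: U_def F_def L of_nat_diff)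
  also have "\<dots> = (\<Sum>d=1..p. \<Sum>k=0..p - d. a ! k * a ! (k + d) * real d powr h)"
    by (rule sum.Sigma[symmetric]) auto
  finally have "(\<Sum>i<L. \<Sum>l<L. F (i, l)) = 2 * (\<Sum>d=1..p. (\<Sum>k=0..p - d. a ! k * a ! (k + d)) * real d powr h)"
    by (simp add: sum_distrib_right)
  thus ?thesis unfolding filter_acf_def by (simp add: F_def L_def p_def sum_negf)
qed

lemma filter_acf_zero_eq_matrix_row:
  assumes "i < length as" and a: "is_increment_filter (as ! i)" and h: "h > 0"
  shows "filter_acf (as ! i) h 0 = (\<Sum>j<max_order as. filter_matrix as $$ (i, j) * real (Suc j) powr h)"
proof -
  define a where "a = as ! i"
  define p where "p = filter_order a"
  define P where "P = max_order as"
  have "p \<le> P" unfolding p_def P_def max_order_def using assms(1) by (intro Max_ge) (auto simp: a_def)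
  have "(\<Sum>j<P. filter_matrix as $$ (i, j) * real (Suc j) powr h) =
      (\<Sum>j<P. (if Suc j \<le> p then - (\<Sum>k=0..p - Suc j. a ! k * a ! (k + Suc j)) * real (Suc j) powr h else 0))"
    using assms(1) by (intro sum.cong refl) (simp add: filter_matrix_def P_def[symmetric] a_def[symmetric] p_def Let_def)
  also have "\<dots> = (\<Sum>j<p. (if Suc j \<le> p then - (\<Sum>k=0..p - Suc j. a ! k * a ! (k + Suc j)) * real (Suc j) powr h else 0))"
    using \<open>p \<le> P\<close> by (intro sum.mono_neutral_right) auto
  also have "\<dots> = (\<Sum>j<p. - (\<Sum>k=0..p - Suc j. a ! k * a ! (k + Suc j)) * real (Suc j) powr h)"
    by (intro sum.cong) auto
  also have "\<dots> = (\<Sum>d=1..p. - (\<Sum>k=0..p - d. a ! k * a ! (k + d)) * real d powr h)"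
    by (simp add: sum.atLeast1_atMost_eq)
  also have "\<dots> = filter_acf a h 0"
    unfolding p_def using filter_acf_zero_eq[of a h] a h by (simp add: a_def)
  finally show ?thesis by (simp add: a_def P_def)
qed

text \<open>\<open>mat_inverse\<close> returns an option, so its success must be derived first. The
  inverse \<open>B\<close> obtained from \<open>full_rank\<close> carries no dimensions; they are
  read off from the two product equations, after which \<open>B\<close> exhibits the Gram matrix as
  a unit of the matrix ring.\<close>

lemma full_rank_left_inverse:
  assumes A: "A \<in> carrier_mat m P" and fr: "full_rank A"
  defines "W \<equiv> the (mat_inverse (transpose_mat A * A)) * transpose_mat A"
  shows "W \<in> carrier_mat P m" and "W * A = 1\<^sub>m P"
proof -
  define G where "G = transpose_mat A * A"
  have AT: "transpose_mat A \<in> carrier_mat P m" using A by simp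
  have G: "G \<in> carrier_mat P P" unfolding G_def using A AT by simp
  obtain B where B: "inverts_mat G B" "inverts_mat B G"
    using fr unfolding full_rank_def invertible_mat_def G_def by blast
  have "mat_inverse G \<noteq> None"
  proof
    assume "mat_inverse G = None"
    hence "G \<notin> Units (ring_mat TYPE(real) P ())" by (rule mat_inverse(1)[OF G])
    moreover have GB: "G * B = 1\<^sub>m P" using B(1) G by (simp add: inverts_mat_def)
    moreover have BG: "B * G = 1\<^sub>m (dim_row B)" using B(2) by (simp add: inverts_mat_def)
    moreover have "dim_col B = P" using GB by (metis index_mult_mat(3) index_one_mat(3))
    moreover have "dim_row B = P" using BG G by (metis index_mult_mat(3) index_one_mat(3) carrier_matD(2))
    moreover have "B \<in> carrier_mat P P" using calculation by auto
    ultimately show False using G unfolding Units_def by (auto simp: ring_mat_simps)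
  qed
  then obtain C where C: "mat_inverse G = Some C" by blast
  hence CG: "C * G = 1\<^sub>m P" "C \<in> carrier_mat P P" using mat_inverse(2)[OF G] by auto
  have W: "W = C * transpose_mat A" using C by (simp add: W_def G_def)
  show "W \<in> carrier_mat P m" unfolding W using CG AT by simp
  show "W * A = 1\<^sub>m P" unfolding W
    using CG assoc_mult_mat[OF CG(2) AT A] by (simp add: G_def)
qed

lemma D_hat_limit:
  assumes fr: "full_rank (filter_matrix as)" and ne: "as \<noteq> []"
    and filt: "\<forall>a\<in>set as. is_increment_filter a" and h: "h > 0"
    and lim: "\<And>a. a \<in> set as \<Longrightarrow>
      (\<lambda>n. c n * filtered_quadratic_variation a n (\<Delta> n) z) \<longlonglongrightarrow> filter_acf a h 0"
    and d: "d < max_order as"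
  shows "(\<lambda>n. c n * vec_index (D_hat as n (\<Delta> n) z) d) \<longlonglongrightarrow> real (Suc d) powr h"
proof -
  define m where "m = length as"
  define P where "P = max_order as"
  define A where "A = filter_matrix as"
  define W where "W = the (mat_inverse (transpose_mat A * A)) * transpose_mat A"
  have A: "A \<in> carrier_mat m P" by (simp add: A_def filter_matrix_def m_def P_def)
  have W: "W \<in> carrier_mat P m" "W * A = 1\<^sub>m P"
    using full_rank_left_inverse[OF A] fr by (simp_all add: A_def W_def)
  define U where "U = (\<lambda>n i. filtered_quadratic_variation (as ! i) n (\<Delta> n) z)"
  have D: "vec_index (D_hat as n (\<Delta> n) z) d = (\<Sum>i<m. W $$ (d, i) * U n i)" for n
  proof -
    have "D_hat as n (\<Delta> n) z = W *\<^sub>v vec m (U n)"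
      by (simp add: D_hat_def Let_def W_def A_def m_def U_def)
    thus ?thesis using W(1) d
      by (simp add: scalar_prod_def P_def[symmetric] atLeast0LessThan[symmetric])
  qed
  have "(\<lambda>n. \<Sum>i<m. W $$ (d, i) * (c n * U n i)) \<longlonglongrightarrow>
      (\<Sum>i<m. W $$ (d, i) * (\<Sum>j<P. A $$ (i, j) * real (Suc j) powr h))"
  proof (intro tendsto_sum tendsto_mult_left)
    fix i assume i: "i \<in> {..<m}"
    hence "as ! i \<in> set as" by (simp add: m_def)
    thus "(\<lambda>n. c n * U n i) \<longlonglongrightarrow> (\<Sum>j<P. A $$ (i, j) * real (Suc j) powr h)"
      using lim[of "as ! i"] filter_acf_zero_eq_matrix_row[of i as h] filt h i
      by (simp add: U_def m_def A_def P_def)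
  qed
  also have "(\<Sum>i<m. W $$ (d, i) * (\<Sum>j<P. A $$ (i, j) * real (Suc j) powr h)) =
      (\<Sum>i<m. \<Sum>j<P. W $$ (d, i) * A $$ (i, j) * real (Suc j) powr h)"
    by (simp add: sum_distrib_left mult.assoc)
  also have "\<dots> = (\<Sum>j<P. \<Sum>i<m. W $$ (d, i) * A $$ (i, j) * real (Suc j) powr h)" by (rule sum.swap)
  also have "\<dots> = (\<Sum>j<P. (W * A) $$ (d, j) * real (Suc j) powr h)"
  proof (intro sum.cong refl)
    fix j assume "j \<in> {..<P}"
    hence "(W * A) $$ (d, j) = (\<Sum>i<m. W $$ (d, i) * A $$ (i, j))"
      using W(1) A d by (simp add: scalar_prod_def P_def[symmetric] atLeast0LessThan[symmetric])
    thus "(\<Sum>i<m. W $$ (d, i) * A $$ (i, j) * real (Suc j) powr h) = (W * A) $$ (d, j) * real (Suc j) powr h"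
      by (simp add: sum_distrib_right)
  qed
  also have "\<dots> = (\<Sum>j<P. if j = d then real (Suc j) powr h else 0)"
    using d by (intro sum.cong refl) (auto simp: W(2) P_def)
  also have "\<dots> = real (Suc d) powr h" using d by (simp add: P_def)
  finally show ?thesis by (simp add: D sum_distrib_left mult_ac)
qed

text \<open>D is the pathwise drift integral. Since T contains all intermediate times, the integrand
  is bounded by the deterministic K between any two of its points, on one almost sure event for all
  pairs.\<close>

lemma sde_solution_lipschitz_drift:
  assumes f: "C01b K T f" and X: "sde_solution M T x f B X"
    and T: "\<And>s t. t \<in> T \<Longrightarrow> 0 \<le> s \<Longrightarrow> s \<le> t \<Longrightarrow> s \<in> T" and T0: "\<And>t. t \<in> T \<Longrightarrow> 0 \<le> t"
  shows "AE \<omega> in M. \<exists>D. (\<forall>t\<in>T. X t \<omega> = x + D t + B t \<omega>) \<and>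
    (\<forall>s\<in>T. \<forall>t\<in>T. \<bar>D t - D s\<bar> \<le> K * \<bar>t - s\<bar>)"
proof -
  have fK: "\<bar>f s y\<bar> \<le> K" if "s \<in> T" for s y
  proof -
    have b: "bdd_above ((\<lambda>(s, x). \<bar>f s x\<bar>) ` (T \<times> UNIV))"
        "bdd_above ((\<lambda>(s, x). \<bar>deriv (f s) x\<bar>) ` (T \<times> UNIV))"
      and le: "(SUP (s, x)\<in>T \<times> UNIV. \<bar>f s x\<bar>) + (SUP (s, x)\<in>T \<times> UNIV. \<bar>deriv (f s) x\<bar>) \<le> K"
      using f by (auto simp: C01b_def)
    have "\<bar>f s y\<bar> \<le> (SUP (s, x)\<in>T \<times> UNIV. \<bar>f s x\<bar>)"
      using cSUP_upper[OF _ b(1), of "(s, y)"] that by simp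
    \<comment> \<open>This makes the second supremum nonnegative, so the first alone is at most
      K.\<close>
    moreover have "\<bar>deriv (f s) y\<bar> \<le> (SUP (s, x)\<in>T \<times> UNIV. \<bar>deriv (f s) x\<bar>)"
      using cSUP_upper[OF _ b(2), of "(s, y)"] that by simp
    ultimately show ?thesis using le by linarith
  qed
  have "AE \<omega> in M. \<forall>t\<in>T. set_integrable lborel {0..t} (\<lambda>s. f s (X s \<omega>)) \<and>
      X t \<omega> = x + (LINT s:{0..t}|lborel. f s (X s \<omega>)) + B t \<omega>"
    using X by (simp add: sde_solution_def)
  thus ?thesis
  proof (rule AE_mp, intro AE_I2 impI)
    fix \<omega>
    define g where "g = (\<lambda>s. f s (X s \<omega>))"
    define D where "D = (\<lambda>t. LINT s:{0..t}|lborel. g s)"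
    assume eq: "\<forall>t\<in>T. set_integrable lborel {0..t} (\<lambda>s. f s (X s \<omega>)) \<and>
      X t \<omega> = x + (LINT s:{0..t}|lborel. f s (X s \<omega>)) + B t \<omega>"
    hence int: "set_integrable lborel {0..t} g" if "t \<in> T" for t using that by (simp add: g_def)
    have mono: "\<bar>D t - D s\<bar> \<le> K * (t - s)" if st: "s \<in> T" "t \<in> T" "s \<le> t" for s t
    proof -
      have s0: "0 \<le> s" using T0 st by auto
      have int': "set_integrable lborel {s<..t} g"
        by (rule set_integrable_subset[OF int[OF st(2)]]) (use s0 in auto)
      have "{0..t} = {0..s} \<union> {s<..t}" "{0..s} \<inter> {s<..t} = {}" using s0 st by auto
      hence "D t = D s + (LINT r:{s<..t}|lborel. g r)"
        unfolding D_def using set_integral_Un[OF _ int[OF st(1)] int'] by simp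
      hence "\<bar>D t - D s\<bar> = norm (LINT r:{s<..t}|lborel. g r)" by simp
      also have "\<dots> \<le> (LINT r:{s<..t}|lborel. norm (g r))"
        by (rule set_integral_norm_bound[OF int'])
      also have "\<dots> \<le> (LINT r:{s<..t}|lborel. K)"
      proof (rule set_integral_mono)
        show "set_integrable lborel {s<..t} (\<lambda>r. norm (g r))"
          using int' by (rule set_integrable_norm)
        show "set_integrable lborel {s<..t} (\<lambda>r. K)"
          using st by (simp add: set_integrable_def)
        show "norm (g r) \<le> K" if "r \<in> {s<..t}" for r
          using fK[OF T[OF st(2), of r], of "X r \<omega>"] that s0 by (simp add: g_def)
      qed
      also have "\<dots> = K * (t - s)"
        using st by (simp add: set_lebesgue_integral_def)
      finally show ?thesis .
    qed
    have "\<bar>D t - D s\<bar> \<le> K * \<bar>t - s\<bar>" if "s \<in> T" "t \<in> T" for s t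
      using mono[of s t] mono[of t s] that by (cases "s \<le> t") (auto simp: abs_minus_commute)
    moreover have "\<forall>t\<in>T. X t \<omega> = x + D t + B t \<omega>" using eq by (simp add: D_def g_def)
    ultimately show "\<exists>D. (\<forall>t\<in>T. X t \<omega> = x + D t + B t \<omega>) \<and>
        (\<forall>s\<in>T. \<forall>t\<in>T. \<bar>D t - D s\<bar> \<le> K * \<bar>t - s\<bar>)" by blast
  qed
qed

lemma log_D_hat_limit:
  assumes a: "\<alpha> > 0" and d: "d \<ge> 1" "d \<le> max_order as"
    and lim: "\<And>d. d < max_order as \<Longrightarrow>
      (\<lambda>n. (real n powr (- \<alpha>)) powr (- 2 * H) * vec_index (D_hat as n (real n powr (- \<alpha>)) z) d) \<longlonglongrightarrow>
        real (Suc d) powr (2 * H)"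
  shows "(\<lambda>n. log_D_hat as n (real n powr (- \<alpha>)) z d - 2 * H * ln (real d * real n powr (- \<alpha>))) \<longlonglongrightarrow> 0"
proof -
  define q where "q = (\<lambda>n. (real n powr (- \<alpha>)) powr (- 2 * H) * vec_index (D_hat as n (real n powr (- \<alpha>)) z) (d - 1))"
  have q: "q \<longlonglongrightarrow> real d powr (2 * H)" using lim[of "d - 1"] d by (simp add: q_def)
  have pos: "real d powr (2 * H) > 0" using d by simp
  have "(\<lambda>n. ln (q n) - 2 * H * ln (real d)) \<longlonglongrightarrow> ln (real d powr (2 * H)) - 2 * H * ln (real d)"
    using pos by (intro tendsto_diff tendsto_ln q tendsto_const) auto
  hence "(\<lambda>n. ln (q n) - 2 * H * ln (real d)) \<longlonglongrightarrow> 0" using d by (simp add: ln_powr)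
  moreover have "eventually (\<lambda>n. ln (q n) - 2 * H * ln (real d) =
      log_D_hat as n (real n powr (- \<alpha>)) z d - 2 * H * ln (real d * real n powr (- \<alpha>))) at_top"
    using order_tendstoD(1)[OF q pos] eventually_gt_at_top[of 0]
  proof eventually_elim
    case (elim n)
    define \<Delta> where "\<Delta> = real n powr (- \<alpha>)"
    have D: "\<Delta> > 0" using elim by (simp add: \<Delta>_def)
    have "vec_index (D_hat as n \<Delta> z) (d - 1) = \<Delta> powr (2 * H) * q n"
    proof -
      have "\<Delta> powr (2 * H) * q n = (\<Delta> powr (2 * H) * \<Delta> powr (- 2 * H)) * vec_index (D_hat as n \<Delta> z) (d - 1)"
        by (simp add: q_def \<Delta>_def)
      also have "\<Delta> powr (2 * H) * \<Delta> powr (- 2 * H) = 1" unfolding powr_add[symmetric] using D by simp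
      finally show ?thesis by simp
    qed
    hence "log_D_hat as n \<Delta> z d = ln (\<Delta> powr (2 * H) * q n)"
      using D elim by (simp add: log_D_hat_def)
    also have "\<dots> = 2 * H * ln \<Delta> + ln (q n)" using D elim by (simp add: ln_mult ln_powr)
    finally have "log_D_hat as n \<Delta> z d = 2 * H * ln \<Delta> + ln (q n)" .
    moreover have "ln (real d * \<Delta>) = ln (real d) + ln \<Delta>" using D d by (simp add: ln_mult)
    ultimately show ?case unfolding \<Delta>_def[symmetric] by (simp add: algebra_simps)
  qed
  ultimately show ?thesis by (rule Lim_transform_eventually)
qed

text \<open>The regressors ln (d \<Delta>) diverge, so no termwise limit is available. With
  residuals r and S the sum of the squared regressors l, the error is the sum of r l divided by 2 S;
  once |l| \<ge> 1, the chain |l| \<le> l^2 \<le> S bounds it by the sum of |r|.\<close>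

lemma H1_hat_limit:
  assumes a: "\<alpha> > 0" and P: "max_order as \<ge> 1"
    and lim: "\<And>d. d \<in> {1..max_order as} \<Longrightarrow>
      (\<lambda>n. log_D_hat as n (real n powr (- \<alpha>)) z d - 2 * H * ln (real d * real n powr (- \<alpha>))) \<longlonglongrightarrow> 0"
  shows "(\<lambda>n. H1_hat as n (real n powr (- \<alpha>)) z) \<longlonglongrightarrow> H"
proof -
  define P where "P = max_order as"
  define l where "l = (\<lambda>n d. ln (real d * real n powr (- \<alpha>)))"
  define r where "r = (\<lambda>n d. log_D_hat as n (real n powr (- \<alpha>)) z d - 2 * H * l n d)"
  have r0: "(\<lambda>n. r n d) \<longlonglongrightarrow> 0" if "d \<in> {1..P}" for d
    using lim[of d] that by (simp add: r_def l_def P_def)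
  have "eventually (\<lambda>n. \<forall>d\<in>{1..P}. \<bar>l n d\<bar> \<ge> 1) at_top"
  proof (rule eventually_ball_finite, simp, rule ballI)
    fix d assume "d \<in> {1..P}"
    hence d: "real d > 0" by simp
    have "eventually (\<lambda>n. ln (real d * real n powr (- \<alpha>)) \<le> - 1) at_top"
      using a d by real_asymp
    thus "eventually (\<lambda>n. \<bar>l n d\<bar> \<ge> 1) at_top"
      by eventually_elim (simp add: l_def)
  qed
  hence "eventually (\<lambda>n. norm (H1_hat as n (real n powr (- \<alpha>)) z - H) \<le> (\<Sum>d=1..P. \<bar>r n d\<bar>)) at_top"
  proof eventually_elim
    case (elim n)
    define S where "S = (\<Sum>d=1..P. (l n d)\<^sup>2)"
    have sq: "1 \<le> (l n d)\<^sup>2" if "d \<in> {1..P}" for d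
      using elim that by (metis abs_one one_power2 abs_le_square_iff)
    have memS: "(l n d)\<^sup>2 \<le> S" if "d \<in> {1..P}" for d
      unfolding S_def using that by (intro member_le_sum) auto
    have S: "S \<ge> 1" using sq[of 1] memS[of 1] P by (simp add: P_def)
    have "(\<Sum>d=1..P. log_D_hat as n (real n powr (- \<alpha>)) z d * l n d) = 2 * H * S + (\<Sum>d=1..P. r n d * l n d)"
      unfolding S_def sum_distrib_left sum.distrib[symmetric]
      by (intro sum.cong refl) (simp add: r_def power2_eq_square algebra_simps)
    hence "H1_hat as n (real n powr (- \<alpha>)) z = (2 * H * S + (\<Sum>d=1..P. r n d * l n d)) / (2 * S)"
      by (simp add: H1_hat_def P_def S_def l_def)
    also have "\<dots> = H + (\<Sum>d=1..P. r n d * l n d) / (2 * S)"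
      using S by (simp add: add_divide_distrib)
    finally have "norm (H1_hat as n (real n powr (- \<alpha>)) z - H) = \<bar>\<Sum>d=1..P. r n d * l n d\<bar> / (2 * S)"
      using S by simp
    also have "\<dots> \<le> (\<Sum>d=1..P. \<bar>r n d\<bar> * S) / (2 * S)"
    proof (intro divide_right_mono order.trans[OF sum_abs] sum_mono)
      fix d assume d: "d \<in> {1..P}"
      have "\<bar>l n d\<bar> * 1 \<le> \<bar>l n d\<bar> * \<bar>l n d\<bar>" using elim d by (intro mult_left_mono) auto
      hence "\<bar>l n d\<bar> \<le> S" using memS[OF d] by (simp add: power2_eq_square)
      thus "\<bar>r n d * l n d\<bar> \<le> \<bar>r n d\<bar> * S" unfolding abs_mult by (intro mult_left_mono) auto
    qed (use S in simp)
    also have "\<dots> = (\<Sum>d=1..P. \<bar>r n d\<bar>) / 2" using S by (simp add: sum_distrib_right[symmetric])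
    also have "\<dots> \<le> (\<Sum>d=1..P. \<bar>r n d\<bar>)" by (simp add: sum_nonneg)
    finally show ?case .
  qed
  moreover have "(\<lambda>n. \<Sum>d=1..P. \<bar>r n d\<bar>) \<longlonglongrightarrow> (\<Sum>d=1..P. 0)"
    by (intro tendsto_sum tendsto_rabs_zero r0)
  hence "(\<lambda>n. \<Sum>d=1..P. \<bar>r n d\<bar>) \<longlonglongrightarrow> 0" by simp
  ultimately have "(\<lambda>n. H1_hat as n (real n powr (- \<alpha>)) z - H) \<longlonglongrightarrow> 0"
    by (rule Lim_null_comparison)
  thus ?thesis by (simp add: LIM_zero_iff)
qed

text \<open>This is P times the empirical variance of ln 1, ..., ln P. It is positive because ln 1
  and ln 2 differ, so at least one of them is not the mean.\<close>

lemma sum_ln_squares_gt: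
  assumes "P \<ge> 2"
  shows "(\<Sum>d=1..P. (ln (real d))\<^sup>2) - 1 / real P * (\<Sum>d=1..P. ln (real d))\<^sup>2 > 0"
proof -
  define m where "m = (\<Sum>d=1..P. ln (real d)) / real P"
  have m: "(\<Sum>d=1..P. ln (real d)) = real P * m" using assms by (simp add: m_def)
  have "(\<Sum>d=1..P. (ln (real d) - m)\<^sup>2) = (\<Sum>d=1..P. (ln (real d))\<^sup>2 - 2 * m * ln (real d) + m\<^sup>2)"
    by (intro sum.cong refl) (simp add: power2_eq_square algebra_simps)
  also have "\<dots> = (\<Sum>d=1..P. (ln (real d))\<^sup>2) - 2 * m * (\<Sum>d=1..P. ln (real d)) + real P * m\<^sup>2"
    by (simp add: sum.distrib sum_subtractf sum_distrib_left)
  also have "\<dots> = (\<Sum>d=1..P. (ln (real d))\<^sup>2) - 1 / real P * (\<Sum>d=1..P. ln (real d))\<^sup>2"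
    unfolding m using assms by (simp add: power2_eq_square)
  finally have eq: "(\<Sum>d=1..P. (ln (real d) - m)\<^sup>2) =
    (\<Sum>d=1..P. (ln (real d))\<^sup>2) - 1 / real P * (\<Sum>d=1..P. ln (real d))\<^sup>2" .
  define k :: nat where "k = (if m = 0 then 2 else 1)"
  have "ln (real k) \<noteq> m" by (simp add: k_def)
  hence "(ln (real k) - m)\<^sup>2 > 0" by simp
  also have "(ln (real k) - m)\<^sup>2 \<le> (\<Sum>d=1..P. (ln (real d) - m)\<^sup>2)"
    by (rule member_le_sum) (use assms in \<open>auto simp: k_def\<close>)
  finally show ?thesis unfolding eq .
qed

text \<open>Centring cancels the summand 2 H ln \<Delta> common to all d. The regressors ln d are
  then fixed, and the residuals pass to the limit termwise.\<close>

lemma H2_hat_limit: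
  assumes P: "max_order as \<ge> 2"
    and lim: "\<And>d. d \<in> {1..max_order as} \<Longrightarrow>
      (\<lambda>n. log_D_hat as n (real n powr (- \<alpha>)) z d - 2 * H * ln (real d * real n powr (- \<alpha>))) \<longlonglongrightarrow> 0"
  shows "(\<lambda>n. H2_hat as n (real n powr (- \<alpha>)) z) \<longlonglongrightarrow> H"
proof -
  define P where "P = max_order as"
  define l where "l = (\<Sum>d=1..P. ln (real d))"
  define V where "V = (\<Sum>d=1..P. (ln (real d))\<^sup>2) - 1 / real P * l\<^sup>2"
  have V: "V > 0" using sum_ln_squares_gt[of P] P by (simp add: V_def P_def l_def)
  define r where "r = (\<lambda>n d. log_D_hat as n (real n powr (- \<alpha>)) z d - 2 * H * ln (real d * real n powr (- \<alpha>)))"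
  have r0: "(\<lambda>n. r n d) \<longlonglongrightarrow> 0" if "d \<in> {1..P}" for d
    using lim[of d] that by (simp add: r_def P_def)
  have P0: "real P > 0" using P by (simp add: P_def)
  have "(\<lambda>n. H + ((\<Sum>d=1..P. r n d * ln (real d)) - 1 / real P * (\<Sum>d=1..P. r n d) * l) / (2 * V)) \<longlonglongrightarrow>
      H + ((\<Sum>d=1..P. 0 * ln (real d)) - 1 / real P * (\<Sum>d=1..P. 0) * l) / (2 * V)"
    using V by (intro tendsto_intros r0) auto
  hence "(\<lambda>n. H + ((\<Sum>d=1..P. r n d * ln (real d)) - 1 / real P * (\<Sum>d=1..P. r n d) * l) / (2 * V)) \<longlonglongrightarrow> H"
    by simp
  moreover have "eventually (\<lambda>n. H + ((\<Sum>d=1..P. r n d * ln (real d)) - 1 / real P * (\<Sum>d=1..P. r n d) * l) / (2 * V) =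
      H2_hat as n (real n powr (- \<alpha>)) z) at_top"
    using eventually_gt_at_top[of 0]
  proof eventually_elim
    case (elim n)
    define \<Delta> where "\<Delta> = real n powr (- \<alpha>)"
    have D: "\<Delta> > 0" using elim by (simp add: \<Delta>_def)
    have L: "log_D_hat as n \<Delta> z d = 2 * H * ln (real d) + 2 * H * ln \<Delta> + r n d" if "d \<in> {1..P}" for d
    proof -
      have "ln (real d * \<Delta>) = ln (real d) + ln \<Delta>" using that D by (simp add: ln_mult)
      thus ?thesis unfolding r_def \<Delta>_def[symmetric] by (simp add: algebra_simps)
    qed
    have s1: "(\<Sum>d=1..P. log_D_hat as n \<Delta> z d * ln (real d)) =
        2 * H * (\<Sum>d=1..P. (ln (real d))\<^sup>2) + 2 * H * ln \<Delta> * l + (\<Sum>d=1..P. r n d * ln (real d))"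
      unfolding l_def sum_distrib_left sum.distrib[symmetric]
      by (intro sum.cong refl) (simp add: L power2_eq_square algebra_simps)
    have "(\<Sum>d=1..P. log_D_hat as n \<Delta> z d) = (\<Sum>d=1..P. 2 * H * ln (real d) + 2 * H * ln \<Delta> + r n d)"
      by (intro sum.cong refl) (rule L)
    hence s2: "(\<Sum>d=1..P. log_D_hat as n \<Delta> z d) = 2 * H * l + real P * (2 * H * ln \<Delta>) + (\<Sum>d=1..P. r n d)"
      by (simp add: sum.distrib sum_distrib_left l_def)
    have "H2_hat as n \<Delta> z = ((\<Sum>d=1..P. log_D_hat as n \<Delta> z d * ln (real d)) -
        1 / real P * (\<Sum>d=1..P. log_D_hat as n \<Delta> z d) * l) / (2 * V)"
      by (simp add: H2_hat_def Let_def P_def V_def l_def)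
    also have "(\<Sum>d=1..P. log_D_hat as n \<Delta> z d * ln (real d)) -
        1 / real P * (\<Sum>d=1..P. log_D_hat as n \<Delta> z d) * l =
        2 * H * V + ((\<Sum>d=1..P. r n d * ln (real d)) - 1 / real P * (\<Sum>d=1..P. r n d) * l)"
      unfolding s1 s2 V_def using P0 by (simp add: field_simps power2_eq_square)
    also have "\<dots> / (2 * V) = H + ((\<Sum>d=1..P. r n d * ln (real d)) - 1 / real P * (\<Sum>d=1..P. r n d) * l) / (2 * V)"
      using V by (simp add: add_divide_distrib)
    finally show ?case by (simp add: \<Delta>_def)
  qed
  ultimately show ?thesis by (rule Lim_transform_eventually)
qed

theorem mainTheorem4:
  fixes M :: "'a measure" and T :: "real set" and H \<alpha> x K :: real
    and f :: "real \<Rightarrow> real \<Rightarrow> real" and B X :: "real \<Rightarrow> 'a \<Rightarrow> real"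
    and as :: "real list list"
  assumes "prob_space M"
    and "fractional_brownian_motion M T H B"
    and "K > 0" and "C01b K T f"
    and "sde_solution M T x f B X"
    and "(T = {0..1} \<and> 0 < H \<and> H < 1 \<and> \<alpha> \<ge> 1) \<or> (T = {0..} \<and> H \<le> 1 / 2 \<and> \<alpha> > 0)"
    and "as \<noteq> []" and "\<forall>a\<in>set as. is_increment_filter a"
    and "full_rank (filter_matrix as)"
  shows "(AE \<omega> in M. (\<lambda>n. H1_hat as n (real n powr (- \<alpha>)) (\<lambda>t. X t \<omega>)) \<longlonglongrightarrow> H) \<and>
         (max_order as \<ge> 2 \<longrightarrow>
           (AE \<omega> in M. (\<lambda>n. H2_hat as n (real n powr (- \<alpha>)) (\<lambda>t. X t \<omega>)) \<longlonglongrightarrow> H))"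
proof -
  interpret prob_space M by fact
  note fbm = assms(2) and filt = assms(8)
  have H: "0 < H" "H < 1" using fbm by (auto simp: fractional_brownian_motion_def)
  have \<alpha>: "\<alpha> > 0" using assms(6) by auto
  \<comment> \<open>The two settings meet here: for \<alpha> \<ge> 1 all n observation times lie in
    the unit interval, otherwise T is the whole half-line.\<close>
  have times: "real k * real n powr (- \<alpha>) \<in> T" if "n \<ge> 1" "k \<le> n" for n k
  proof -
    have "real k * real n powr (- \<alpha>) \<le> 1" if "\<alpha> \<ge> 1"
    proof -
      have "real k * real n powr (- \<alpha>) \<le> real n * real n powr (- 1)"
        using \<open>n \<ge> 1\<close> \<open>k \<le> n\<close> that by (intro mult_mono powr_mono) auto
      also have "\<dots> = 1" using \<open>n \<ge> 1\<close> by (simp add: powr_minus_divide)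
      finally show ?thesis .
    qed
    thus ?thesis using assms(6) by auto
  qed
  \<comment> \<open>The filters are finitely many, so their exceptional null sets can be united.
    With \<open>drift\<close> this is all the probabilistic input; the rest is deterministic along a
    fixed path.\<close>
  have qvB: "AE \<omega> in M. \<forall>a\<in>set as. (\<lambda>n. (real n powr (- \<alpha>)) powr (- 2 * H) *
      filtered_quadratic_variation a n (real n powr (- \<alpha>)) (\<lambda>t. B t \<omega>)) \<longlonglongrightarrow> filter_acf a (2 * H) 0"
    using filt by (intro AE_finite_allI fbm_quadratic_variation_limit[OF fbm] times) auto
  have drift: "AE \<omega> in M. \<exists>D. (\<forall>t\<in>T. X t \<omega> = x + D t + B t \<omega>) \<and>
    (\<forall>s\<in>T. \<forall>t\<in>T. \<bar>D t - D s\<bar> \<le> K * \<bar>t - s\<bar>)"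
    by (rule sde_solution_lipschitz_drift[OF assms(4,5)]) (use assms(6) in auto)
  have P1: "max_order as \<ge> 1"
  proof -
    obtain a where a: "a \<in> set as" using assms(7) by (cases as) auto
    have "filter_order a \<ge> 1" using a filt by (auto simp: is_increment_filter_def filter_order_def)
    moreover have "filter_order a \<le> max_order as" unfolding max_order_def using a by (intro Max_ge) auto
    ultimately show ?thesis by simp
  qed
  have "AE \<omega> in M. (\<lambda>n. H1_hat as n (real n powr (- \<alpha>)) (\<lambda>t. X t \<omega>)) \<longlonglongrightarrow> H \<and>
      (max_order as \<ge> 2 \<longrightarrow> (\<lambda>n. H2_hat as n (real n powr (- \<alpha>)) (\<lambda>t. X t \<omega>)) \<longlonglongrightarrow> H)"
    using qvB drift
  proof eventually_elim
    case (elim \<omega>)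
    then obtain D where D: "\<And>t. t \<in> T \<Longrightarrow> X t \<omega> = x + D t + B t \<omega>"
      "\<And>s t. s \<in> T \<Longrightarrow> t \<in> T \<Longrightarrow> \<bar>D t - D s\<bar> \<le> K * \<bar>t - s\<bar>" by blast
    have qvX: "(\<lambda>n. (real n powr (- \<alpha>)) powr (- 2 * H) *
        filtered_quadratic_variation a n (real n powr (- \<alpha>)) (\<lambda>t. X t \<omega>)) \<longlonglongrightarrow> filter_acf a (2 * H) 0"
      if a: "a \<in> set as" for a
    proof -
      define VB where "VB = (\<lambda>n. (real n powr (- \<alpha>)) powr (- 2 * H) *
        filtered_quadratic_variation a n (real n powr (- \<alpha>)) (\<lambda>t. B t \<omega>))"
      define VX where "VX = (\<lambda>n. (real n powr (- \<alpha>)) powr (- 2 * H) *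
        filtered_quadratic_variation a n (real n powr (- \<alpha>)) (\<lambda>t. X t \<omega>))"
      define e where "e = (\<lambda>n. (\<Sum>i<length a. \<bar>a ! i\<bar>) * K * real (filter_order a) *
        (real n powr (- \<alpha>)) powr (1 - H))"
      have VB: "VB \<longlonglongrightarrow> filter_acf a (2 * H) 0" using elim(1) a by (simp add: VB_def)
      \<comment> \<open>The rescaled drift is of order n^(-\<alpha> (1 - H)), which vanishes because
        \<alpha> > 0 and H < 1.\<close>
      have "(\<lambda>n. (real n powr (- \<alpha>)) powr (1 - H)) \<longlonglongrightarrow> 0"
      proof -
        have "- \<alpha> * (1 - H) < 0" using \<alpha> H by (simp add: mult_neg_pos)
        hence "(\<lambda>n. real n powr (- \<alpha> * (1 - H))) \<longlonglongrightarrow> 0" by real_asymp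
        thus ?thesis by (simp add: powr_powr)
      qed
      hence e: "e \<longlonglongrightarrow> 0" unfolding e_def by (rule tendsto_mult_right_zero)
      have "eventually (\<lambda>n. norm (VX n - VB n) \<le> e n * VB n + e n + (e n)\<^sup>2) at_top"
        using eventually_ge_at_top[of 1]
      proof eventually_elim
        case (elim n)
        show ?case unfolding VX_def VB_def e_def real_norm_def
          by (rule filtered_quadratic_variation_perturbation[where T = T and D = D and x = x])
            (use filt a assms(3) D times[OF elim] elim in auto)
      qed
      moreover have "(\<lambda>n. e n * VB n + e n + (e n)\<^sup>2) \<longlonglongrightarrow> 0 * filter_acf a (2 * H) 0 + 0 + 0\<^sup>2"
        by (intro tendsto_intros e VB)
      hence "(\<lambda>n. e n * VB n + e n + (e n)\<^sup>2) \<longlonglongrightarrow> 0" by simp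
      ultimately have "(\<lambda>n. VX n - VB n) \<longlonglongrightarrow> 0" by (rule Lim_null_comparison)
      from tendsto_add[OF this VB] show ?thesis by (simp add: VX_def)
    qed
    have "(\<lambda>n. log_D_hat as n (real n powr (- \<alpha>)) (\<lambda>t. X t \<omega>) d -
        2 * H * ln (real d * real n powr (- \<alpha>))) \<longlonglongrightarrow> 0" if "d \<in> {1..max_order as}" for d
    proof (rule log_D_hat_limit[OF \<alpha>])
      show "(\<lambda>n. (real n powr (- \<alpha>)) powr (- 2 * H) *
          vec_index (D_hat as n (real n powr (- \<alpha>)) (\<lambda>t. X t \<omega>)) d) \<longlonglongrightarrow> real (Suc d) powr (2 * H)"
        if "d < max_order as" for d
        by (rule D_hat_limit[OF assms(9,7) filt _ qvX that]) (use H in auto)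
    qed (use that in auto)
    thus ?case using H1_hat_limit[OF \<alpha> P1] H2_hat_limit by blast
  qed
  thus ?thesis by (auto elim: AE_mp)
qed

end
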